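(* Let $V$ be a euclidean space of dimension $n\ge 2$, let $c(t)$ be a regular curve in $V$ and let $\kappa_1(t),\dots,\kappa_{n-1}(t)$ be its curvatures. Let $L:V\to V$ be an invertible linear mapping, let $\lambda\in V$ be arbitrary, and set $\tilde c(t)=Lc(t)+\lambda$. Denote by $\tilde\kappa_1(t),\dots,\tilde\kappa_{n-1}(t)$ the curvatures of $\tilde c$. Let $\sigma_1\ge\sigma_2\ge\cdots\ge\sigma_n$ be the singular values of $L$. Then for $1\le r\le n-2$, $$\frac{\sigma_{n-r}\sigma_{n-r+1}\sigma_{n-r+2}^2\cdots\sigma_n^2}{\sigma_1^3\sigma_2^2\cdots\sigma_r^2}\,\kappa_r\ \le\ \tilde\kappa_r\ \le\ \frac{\sigma_1^2\cdots\sigma_{r-1}^2\sigma_r\sigma_{r+1}}{\sigma_{n-r+1}^2\cdots\sigma_{n-1}^2\sigma_n^3}\,\kappa_r .$$ For the torsion, $$\frac{\sigma_n^2}{\sigma_1^2\sigma_2}\,|\kappa_{n-1}|\ \le\ |\tilde\kappa_{n-1}|\ \le\ \frac{\sigma_1^2}{\sigma_{n-1}\sigma_n^2}\,|\kappa_{n-1}| .$$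
   Context: A euclidean space is a finite-dimensional, oriented, real vector space $V$ with a positive definite scalar product $\langle\cdot,\cdot\rangle$. A regular curve in $V$ ($\dim V=n$) is a map $c:[a,b]\to V$, $a<b$, which is differentiable as many times as needed and such that $c'(t),\dots,c^{(n-1)}(t)$ are linearly independent for every $t\in[a,b]$. Frenet-Serret frame $e(t)=(e_1(t),\dots,e_n(t))$: $e_1,\dots,e_{n-1}$ is the Gram-Schmidt orthonormalization of $c',\dots,c^{(n-1)}$ (so $e_i$ is a linear combination of $c',\dots,c^{(i)}$ with positive coefficient at $c^{(i)}$), and $e_n$ is the unique vector making $e_1,\dots,e_n$ a positive orthonormal basis. The curvatures $\kappa_1,\dots,\kappa_{n-1}$ are the functions determined by the Frenet-Serret equation $e_i'=\|c'\|\,(-\kappa_{i-1}e_{i-1}+\kappa_i e_{i+1})$, $1\le i\le n$ (terms involving $e_0$ or $e_{n+1}$ are absent); equivalently $\kappa_r=\langle e_r',e_{r+1}\rangle/\|c'\|$. The top curvature $\kappa_{n-1}$ is called the torsion. In the products of squares above, ranges of indices that are empty contribute the factor $1$: the lower coefficient is $(\sigma_{n-r+2}\cdots\sigma_n)(\sigma_{n-r}\cdots\sigma_n)/\big((\sigma_1\cdots\sigma_r)^2\sigma_1\big)$ and the upper coefficient is $(\sigma_1\cdots\sigma_{r-1})(\sigma_1\cdots\sigma_{r+1})/\big((\sigma_{n-r+1}\cdots\sigma_n)^2\sigma_n\big)$. *)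

theory Defs
  imports "HOL-Analysis.Analysis" "Jordan_Normal_Form.Determinant"
begin

section \<open>Oriented euclidean spaces\<close>

definition ordered_basis :: "'a::euclidean_space list \<Rightarrow> bool" where
  "ordered_basis bs \<longleftrightarrow> distinct bs \<and> independent (set bs) \<and> span (set bs) = UNIV"

text \<open>Column \<open>j\<close> holds the coordinates of the \<open>j\<close>-th vector of \<open>cs\<close> with respect to \<open>bs\<close>.\<close>

definition transition_matrix :: "'a::euclidean_space list \<Rightarrow> 'a list \<Rightarrow> real mat" where
  "transition_matrix bs cs =
     Matrix.mat DIM('a) DIM('a) (\<lambda>(i, j). representation (set bs) (cs ! j) (bs ! i))"

text \<open>An orientation is an equivalence class of ordered bases. Its members are the positive bases.\<close>

definition is_orientation :: "'a::euclidean_space list set \<Rightarrow> bool" where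
  "is_orientation \<Omega> \<longleftrightarrow> (\<exists>bs. ordered_basis bs \<and>
     \<Omega> = {cs. ordered_basis cs \<and> Determinant.det (transition_matrix bs cs) > 0})"

definition orthonormal_list :: "'a::euclidean_space list \<Rightarrow> bool" where
  "orthonormal_list vs \<longleftrightarrow>
     (\<forall>i<length vs. \<forall>j<length vs. inner (vs ! i) (vs ! j) = (if i = j then 1 else 0))"


section \<open>Regular curves\<close>

text \<open>Derivatives are taken within \<open>[a,b]\<close>, hence are one-sided at the end points.\<close>

definition nth_vderiv :: "real \<Rightarrow> real \<Rightarrow> nat \<Rightarrow> (real \<Rightarrow> 'a::euclidean_space) \<Rightarrow> real \<Rightarrow> 'a" where
  "nth_vderiv a b k c = ((\<lambda>f t. vector_derivative f (at t within {a..b})) ^^ k) c"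

text \<open>\<open>DIM('a)\<close> derivatives are exactly as many as are needed for all the curvatures to be defined.
  The independence of \<open>c', \<dots>, c\<^sup>(\<^sup>n\<^sup>-\<^sup>1\<^sup>)\<close> is that of a family, hence the injectivity.\<close>

definition regular_curve :: "real \<Rightarrow> real \<Rightarrow> (real \<Rightarrow> 'a::euclidean_space) \<Rightarrow> bool" where
  "regular_curve a b c \<longleftrightarrow> a < b \<and>
     (\<forall>k<DIM('a). nth_vderiv a b k c differentiable_on {a..b}) \<and>
     (\<forall>t\<in>{a..b}. inj_on (\<lambda>k. nth_vderiv a b k c t) {1..<DIM('a)} \<and>
                  independent ((\<lambda>k. nth_vderiv a b k c t) ` {1..<DIM('a)}))"


section \<open>Frenet-Serret frame and curvatures\<close>

text \<open>Indices start at \<open>1\<close>. For a real vector, \<open>sgn x = x /\<^sub>R norm x\<close>.\<close>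

function gram_schmidt :: "(nat \<Rightarrow> 'a::euclidean_space) \<Rightarrow> nat \<Rightarrow> 'a" where
  "gram_schmidt v i =
     sgn (v i - (\<Sum>j\<in>{1..<i}. inner (v i) (gram_schmidt v j) *\<^sub>R gram_schmidt v j))"
  by auto
termination by (relation "inv_image less_than snd") auto

declare gram_schmidt.simps [simp del]

definition frenet_frame ::
    "'a::euclidean_space list set \<Rightarrow> real \<Rightarrow> real \<Rightarrow> (real \<Rightarrow> 'a) \<Rightarrow> nat \<Rightarrow> real \<Rightarrow> 'a" where
  "frenet_frame \<Omega> a b c i t =
     (let e = gram_schmidt (\<lambda>k. nth_vderiv a b k c t)
      in if i < DIM('a) then e i
         else (THE v. orthonormal_list (map e [1..<DIM('a)] @ [v]) \<and>
                      map e [1..<DIM('a)] @ [v] \<in> \<Omega>))"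

text \<open>The Frenet-Serret equation \<open>e\<^sub>r' = \<parallel>c'\<parallel> (- \<kappa>\<^sub>r\<^sub>-\<^sub>1 e\<^sub>r\<^sub>-\<^sub>1 + \<kappa>\<^sub>r e\<^sub>r\<^sub>+\<^sub>1)\<close>, solved for \<open>\<kappa>\<^sub>r\<close>
  (\<open>1 \<le> r < n\<close>) by taking the inner product with \<open>e\<^sub>r\<^sub>+\<^sub>1\<close>; see the lemma below.\<close>

definition curvature ::
    "'a::euclidean_space list set \<Rightarrow> real \<Rightarrow> real \<Rightarrow> (real \<Rightarrow> 'a) \<Rightarrow> nat \<Rightarrow> real \<Rightarrow> real" where
  "curvature \<Omega> a b c r t =
     inner (vector_derivative (frenet_frame \<Omega> a b c r) (at t within {a..b}))
           (frenet_frame \<Omega> a b c (r + 1) t)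
     / norm (vector_derivative c (at t within {a..b}))"

lemma frenet_serret_imp_curvature:
  fixes c :: "real \<Rightarrow> 'a::euclidean_space" and \<kappa> :: "nat \<Rightarrow> real" and a b :: real
    and \<Omega> :: "'a list set"
  defines "e \<equiv> frenet_frame \<Omega> a b c"
  defines "s \<equiv> \<lambda>t. norm (vector_derivative c (at t within {a..b}))"
  assumes ab: "a < b" "t \<in> {a..b}" and r: "1 \<le> r" "r < DIM('a)"
    and s: "s t \<noteq> 0"
    and onb: "\<And>i j. i \<in> {1..DIM('a)} \<Longrightarrow> j \<in> {1..DIM('a)} \<Longrightarrow>
                inner (e i t) (e j t) = (if i = j then 1 else 0)"
    and fs: "(e r has_vector_derivative
               s t *\<^sub>R ((if r = 1 then 0 else - \<kappa> (r - 1) *\<^sub>R e (r - 1) t) + \<kappa> r *\<^sub>R e (r + 1) t))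
             (at t within {a..b})"
  shows "curvature \<Omega> a b c r t = \<kappa> r"
proof -
  have "vector_derivative (e r) (at t within {a..b}) =
      s t *\<^sub>R ((if r = 1 then 0 else - \<kappa> (r - 1) *\<^sub>R e (r - 1) t) + \<kappa> r *\<^sub>R e (r + 1) t)"
    by (rule vector_derivative_within_closed_interval[OF ab fs])
  moreover have "r \<noteq> 1 \<Longrightarrow> inner (e (r - 1) t) (e (r + 1) t) = 0"
    using r by (subst onb) auto
  moreover have "inner (e (r + 1) t) (e (r + 1) t) = 1"
    using r by (subst onb) auto
  ultimately have "inner (vector_derivative (e r) (at t within {a..b})) (e (r + 1) t) = s t * \<kappa> r"
    by (simp add: inner_add_left)
  then show ?thesis
    using s unfolding curvature_def e_def s_def by simp
qed


section \<open>Singular values\<close>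

text \<open>\<open>\<sigma> 1 \<ge> \<dots> \<ge> \<sigma> n \<ge> 0\<close> are the square roots of the eigenvalues of \<open>L\<^sup>* L\<close>, each repeated
  according to its multiplicity; as \<open>L\<^sup>* L\<close> is self-adjoint, the latter is the dimension of the
  eigenspace.\<close>

definition singular_values :: "('a::euclidean_space \<Rightarrow> 'a) \<Rightarrow> (nat \<Rightarrow> real) \<Rightarrow> bool" where
  "singular_values L \<sigma> \<longleftrightarrow>
     (\<forall>i\<in>{1..DIM('a)}. \<sigma> i \<ge> 0) \<and>
     (\<forall>i\<in>{1..DIM('a)}. \<forall>j\<in>{1..DIM('a)}. i \<le> j \<longrightarrow> \<sigma> j \<le> \<sigma> i) \<and>
     (\<forall>s\<ge>0. card {i\<in>{1..DIM('a)}. \<sigma> i = s} = dim {x. adjoint L (L x) = s\<^sup>2 *\<^sub>R x})"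

end

theory Submission
  imports Defs
begin

text \<open>
  Let \<open>V\<^sub>r\<close> be the volume of the parallelepiped spanned by \<open>c', \<dots>, c\<^sup>(\<^sup>r\<^sup>)\<close>. Differentiating the
  Gram-Schmidt formula gives \<open>\<bar>\<kappa>\<^sub>r\<bar> = V\<^sub>r\<^sub>+\<^sub>1 V\<^sub>r\<^sub>-\<^sub>1 / (V\<^sub>r\<^sup>2 V\<^sub>1)\<close>. An invertible linear map \<open>L\<close> multiplies
  \<open>r\<close>-dimensional volumes by a factor between the product of its \<open>r\<close> smallest and the product of its
  \<open>r\<close> largest singular values, which bounds the ratio of the curvatures. For the torsion these two
  products coincide at \<open>r = n\<close>, hence the cancellations in the bounds.
\<close>

text \<open>The Frenet frames of \<open>c\<close> and of its image cannot be compared vector by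
  vector, since \<open>L\<close> does not preserve orthogonality. What \<open>L\<close> does carry
  over is the flag of the spans of c', ..., c^(i), and each frame is an orthonormal family adapted
  to its own flag. In such a family the derivatives have a triangular coordinate matrix. Its
  diagonal entries w_i are the heights of c^(i) over the preceding span, and V_k is the absolute
  value of w_1 ... w_k. The Frenet-Serret equation gives \<kappa>_r = w_{r+1} / (w_r w_1), and
  rewriting heights as quotients of successive volumes produces the formula for the curvature. The
  distortion of volumes is bounded by a min-max argument: a k-dimensional subspace contains a unit
  vector orthogonal to k - 1 prescribed vectors, and the prescribed ones are singular vectors.
  Regularity does not make c^(n) independent of the lower derivatives. So V_n may vanish, and the
  sign of w_n comes from the orientation; this is why the torsion is estimated in absolute value.
  For r \<le> n - 2 all heights involved are positive and the absolute values disappear.\<close>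

section \<open>Orthonormal families and dimension counts\<close>

definition orthonormal_family :: "(nat \<Rightarrow> 'a::euclidean_space) \<Rightarrow> nat \<Rightarrow> bool" where
  "orthonormal_family e r \<longleftrightarrow>
     (\<forall>i\<in>{1..r}. \<forall>j\<in>{1..r}. inner (e i) (e j) = (if i = j then 1 else 0))"

lemma orthonormal_familyD:
  "orthonormal_family e r \<Longrightarrow> i \<in> {1..r} \<Longrightarrow> j \<in> {1..r} \<Longrightarrow>
     inner (e i) (e j) = (if i = j then 1 else 0)"
  by (simp add: orthonormal_family_def)

lemma orthonormal_family_mono:
  "orthonormal_family e r \<Longrightarrow> s \<le> r \<Longrightarrow> orthonormal_family e s"
  by (simp add: orthonormal_family_def)

lemma orthonormal_family_inner_sum:
  assumes "orthonormal_family e r" "j \<in> {1..r}" "I \<subseteq> {1..r}"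
  shows "inner (\<Sum>i\<in>I. a i *\<^sub>R e i) (e j) = (if j \<in> I then a j else 0)"
proof -
  have fin: "finite I" using assms(3) finite_subset by blast
  have "inner (\<Sum>i\<in>I. a i *\<^sub>R e i) (e j) = (\<Sum>i\<in>I. if i = j then a i else 0)"
    unfolding inner_sum_left
    by (rule sum.cong) (use assms in \<open>auto simp: orthonormal_familyD[OF assms(1)] subset_iff\<close>)
  then show ?thesis using fin by simp
qed

lemma orthonormal_family_inj_on:
  assumes "orthonormal_family e r"
  shows "inj_on e {1..r}"
proof (rule inj_onI)
  fix i j assume ij: "i \<in> {1..r}" "j \<in> {1..r}" "e i = e j"
  then have "inner (e i) (e j) = 1"
    using orthonormal_familyD[OF assms ij(1) ij(1)] by simp
  then show "i = j"
    using orthonormal_familyD[OF assms ij(1) ij(2)] by (auto split: if_splits)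
qed

lemma orthonormal_family_independent:
  assumes "orthonormal_family e r"
  shows "independent (e ` {1..r})"
proof (rule pairwise_orthogonal_independent)
  show "pairwise Linear_Algebra.orthogonal (e ` {1..r})"
    unfolding pairwise_def Linear_Algebra.orthogonal_def
    using orthonormal_familyD[OF assms] by fastforce
  show "0 \<notin> e ` {1..r}"
    using orthonormal_familyD[OF assms] by fastforce
qed

lemma orthonormal_family_dim_span:
  assumes "orthonormal_family e r"
  shows "dim (span (e ` {1..r})) = r"
proof -
  have "dim (span (e ` {1..r})) = card (e ` {1..r})"
    using dim_eq_card_independent[OF orthonormal_family_independent[OF assms]] by simp
  then show ?thesis
    using card_image[OF orthonormal_family_inj_on[OF assms]] by simp
qed

text \<open>The difference of the two sides lies in the span and is orthogonal to every generator of
  it, hence to itself.\<close>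

lemma orthonormal_family_expansion:
  assumes "orthonormal_family e r" "x \<in> span (e ` {1..r})"
  shows "x = (\<Sum>j\<in>{1..r}. inner x (e j) *\<^sub>R e j)"
proof -
  define d where "d = x - (\<Sum>j\<in>{1..r}. inner x (e j) *\<^sub>R e j)"
  have "d \<in> span (e ` {1..r})"
    unfolding d_def using assms(2)
    by (intro span_diff span_sum span_scale) (auto intro: span_base)
  moreover have "Linear_Algebra.orthogonal d y" if "y \<in> e ` {1..r}" for y
    using that orthonormal_family_inner_sum[OF assms(1), of _ "{1..r}"]
    by (auto simp: d_def Linear_Algebra.orthogonal_def inner_diff_left)
  ultimately have "Linear_Algebra.orthogonal d d"
    by (rule orthogonal_to_span)
  then show ?thesis by (simp add: d_def Linear_Algebra.orthogonal_def)
qed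

lemma orthonormal_family_of_subspace:
  fixes S :: "'a::euclidean_space set"
  assumes "subspace S"
  obtains e where "orthonormal_family e (dim S)" "span (e ` {1..dim S}) = S"
proof -
  obtain B where B: "B \<subseteq> S" "pairwise Linear_Algebra.orthogonal B" "\<And>x. x \<in> B \<Longrightarrow> norm x = 1"
    "independent B" "card B = dim S" "span B = S"
    using orthonormal_basis_subspace[OF assms] by metis
  have "finite B" using B(4) independent_imp_finite by blast
  then obtain e where e: "bij_betw e {1..card B} B"
    using ex_bij_betw_nat_finite_1 by blast
  have im: "e ` {1..dim S} = B" using e B(5) by (simp add: bij_betw_def)
  have "orthonormal_family e (dim S)"
    unfolding orthonormal_family_def
  proof (intro ballI)
    fix i j assume ij: "i \<in> {1..dim S}" "j \<in> {1..dim S}"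
    have mem: "e i \<in> B" "e j \<in> B" using im ij by blast+
    show "inner (e i) (e j) = (if i = j then 1 else 0)"
    proof (cases "i = j")
      case True
      then show ?thesis using B(3)[OF mem(1)] by (simp add: norm_eq_1)
    next
      case False
      then have "e i \<noteq> e j" using e ij B(5) by (auto simp: bij_betw_def inj_on_def)
      then show ?thesis using B(2) mem False by (simp add: pairwise_def Linear_Algebra.orthogonal_def)
    qed
  qed
  then show thesis using that im B(6) by simp
qed

text \<open>The orthogonal complement of \<open>U\<close> has codimension at most
  \<open>card U\<close>, which is less than \<open>dim S\<close>, so it meets \<open>S\<close>
  outside 0. This serves both the min-max bound for volumes and the existence of the last frame
  vector.\<close>

lemma subspace_meets_orthogonal_complement:
  fixes S U :: "'a::euclidean_space set"
  assumes "subspace S" "finite U" "card U < dim S"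
  obtains z where "z \<in> S" "norm z = 1" "\<And>u. u \<in> U \<Longrightarrow> inner z u = 0"
proof -
  define T where "T = {y. \<forall>x\<in>span U. Linear_Algebra.orthogonal x y}"
  have sT: "subspace T" unfolding T_def by (rule subspace_orthogonal_to_vectors)
  have "dim T + dim (span U) = DIM('a)"
    using dim_subspace_orthogonal_to_vectors[of "span U" UNIV] by (simp add: T_def)
  moreover have "dim (span U) \<le> card U"
    using dim_le_card[OF subset_refl assms(2)] by (simp add: dim_span)
  moreover have "dim {x + y |x y. x \<in> S \<and> y \<in> T} + dim (S \<inter> T) = dim S + dim T"
    by (rule dim_sums_Int[OF assms(1) sT])
  moreover have "dim {x + y |x y. x \<in> S \<and> y \<in> T} \<le> DIM('a)"
    by (rule dim_subset_UNIV)
  ultimately have "dim (S \<inter> T) \<noteq> 0" using assms(3) by linarith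
  then obtain y where y: "y \<in> S" "y \<in> T" "y \<noteq> 0"
    by (auto simp: dim_eq_0)
  show thesis
  proof (rule that[of "sgn y"])
    show "sgn y \<in> S" using assms(1) y by (simp add: sgn_div_norm subspace_scale)
    show "norm (sgn y) = 1" using y by (simp add: norm_sgn)
    show "inner (sgn y) u = 0" if "u \<in> U" for u
    proof -
      have "Linear_Algebra.orthogonal u y" using y(2) span_base[OF that] by (simp add: T_def)
      then show ?thesis by (simp add: sgn_div_norm Linear_Algebra.orthogonal_def inner_commute)
    qed
  qed
qed

section \<open>Gram determinants\<close>

text \<open>The determinant is the squared volume of the parallelepiped spanned by x_1, ..., x_r.
  Matrices count from 0 and families from 1, hence \<open>Suc\<close>.\<close>

definition gram_mat :: "(nat \<Rightarrow> 'a::euclidean_space) \<Rightarrow> nat \<Rightarrow> real mat" where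
  "gram_mat x r = Matrix.mat r r (\<lambda>(i, j). inner (x (Suc i)) (x (Suc j)))"

definition coord_mat ::
    "(nat \<Rightarrow> 'a::euclidean_space) \<Rightarrow> (nat \<Rightarrow> 'a) \<Rightarrow> nat \<Rightarrow> real mat" where
  "coord_mat x e r = Matrix.mat r r (\<lambda>(i, j). inner (x (Suc i)) (e (Suc j)))"

lemma gram_mat_carrier [simp]: "gram_mat x r \<in> carrier_mat r r"
  and coord_mat_carrier [simp]: "coord_mat x e r \<in> carrier_mat r r"
  by (simp_all add: gram_mat_def coord_mat_def)

lemma sum_Suc_lessThan_eq: "(\<Sum>k = 0..<r. f (Suc k)) = (\<Sum>k\<in>{1..r}. f k)"
  by (rule sum.reindex_bij_witness[where i="\<lambda>k. k - 1" and j=Suc]) auto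

lemma prod_Suc_lessThan_eq: "(\<Prod>k = 0..<r. f (Suc k)) = (\<Prod>k\<in>{1..r}. f k)"
  by (rule prod.reindex_bij_witness[where i="\<lambda>k. k - 1" and j=Suc]) auto

text \<open>By linearity \<open>M (x i)\<close> has the same coefficients with respect to the
  \<open>M (e k)\<close> as \<open>x i\<close> with respect to the \<open>e k\<close>; expand both
  arguments of the scalar product.\<close>

lemma gram_mat_change_of_basis:
  assumes M: "linear M"
    and x: "\<And>i. i \<in> {1..r} \<Longrightarrow> x i = (\<Sum>j\<in>{1..r}. inner (x i) (e j) *\<^sub>R e j)"
  shows "gram_mat (\<lambda>i. M (x i)) r =
    coord_mat x e r * gram_mat (\<lambda>i. M (e i)) r * transpose_mat (coord_mat x e r)"
proof (rule eq_matI)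
  fix i j assume "i < dim_row (coord_mat x e r * gram_mat (\<lambda>i. M (e i)) r * transpose_mat (coord_mat x e r))"
    "j < dim_col (coord_mat x e r * gram_mat (\<lambda>i. M (e i)) r * transpose_mat (coord_mat x e r))"
  then have ij: "i < r" "j < r" by (simp_all add: coord_mat_def)
  have Mx: "M (x (Suc i)) = (\<Sum>k\<in>{1..r}. inner (x (Suc i)) (e k) *\<^sub>R M (e k))" if "i < r" for i
    using that by (subst x) (auto simp: linear_sum[OF M] linear_scale[OF M])
  have "(coord_mat x e r * gram_mat (\<lambda>i. M (e i)) r * transpose_mat (coord_mat x e r)) $$ (i, j) =
    (\<Sum>l = 0..<r. (\<Sum>k = 0..<r. inner (x (Suc i)) (e (Suc k)) * inner (M (e (Suc k))) (M (e (Suc l))))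
        * inner (x (Suc j)) (e (Suc l)))"
    using ij by (simp add: coord_mat_def gram_mat_def scalar_prod_def)
  also have "\<dots> = (\<Sum>l\<in>{1..r}. (\<Sum>k\<in>{1..r}. inner (x (Suc i)) (e k) * inner (M (e k)) (M (e l)))
        * inner (x (Suc j)) (e l))"
    by (simp only: sum_Suc_lessThan_eq[where f="\<lambda>k. inner (x (Suc i)) (e k) * inner (M (e k)) z" for z]
         sum_Suc_lessThan_eq[where f="\<lambda>l. (\<Sum>k\<in>{1..r}. inner (x (Suc i)) (e k) * inner (M (e k)) (M (e l)))
        * inner (x (Suc j)) (e l)"])
  also have "\<dots> = inner (M (x (Suc i))) (M (x (Suc j)))"
    by (simp only: Mx[OF ij(1)] Mx[OF ij(2)] inner_sum_left inner_sum_right inner_scaleR_left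
        inner_scaleR_right sum_distrib_right sum_distrib_left) (simp add: mult.commute)
  also have "\<dots> = gram_mat (\<lambda>i. M (x i)) r $$ (i, j)" using ij by (simp add: gram_mat_def)
  finally show "gram_mat (\<lambda>i. M (x i)) r $$ (i, j) =
    (coord_mat x e r * gram_mat (\<lambda>i. M (e i)) r * transpose_mat (coord_mat x e r)) $$ (i, j)" by simp
qed (simp_all add: coord_mat_def gram_mat_def)

text \<open>The squared factor does not involve \<open>M\<close>. Comparison with the identity map
  therefore shows that \<open>M\<close> distorts the volume of \<open>x\<close> by the same factor
  as that of \<open>e\<close>.\<close>

lemma det_gram_change_of_basis:
  assumes "linear M"
    and "\<And>i. i \<in> {1..r} \<Longrightarrow> x i = (\<Sum>j\<in>{1..r}. inner (x i) (e j) *\<^sub>R e j)"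
  shows "Determinant.det (gram_mat (\<lambda>i. M (x i)) r) =
    (Determinant.det (coord_mat x e r))\<^sup>2 * Determinant.det (gram_mat (\<lambda>i. M (e i)) r)"
proof -
  let ?C = "coord_mat x e r" and ?G = "gram_mat (\<lambda>i. M (e i)) r"
  have "Determinant.det (gram_mat (\<lambda>i. M (x i)) r) = Determinant.det (?C * ?G * transpose_mat ?C)"
    by (subst gram_mat_change_of_basis[OF assms]) simp_all
  also have "\<dots> = Determinant.det (?C * ?G) * Determinant.det (transpose_mat ?C)"
    by (rule det_mult[where n=r]) (auto intro!: mult_carrier_mat[where n=r])
  also have "Determinant.det (?C * ?G) = Determinant.det ?C * Determinant.det ?G"
    by (rule det_mult[where n=r]) auto
  also have "Determinant.det (transpose_mat ?C) = Determinant.det ?C"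
    by (rule Determinant.det_transpose[where n=r]) auto
  finally show ?thesis by (simp add: power2_eq_square)
qed

lemma gram_mat_orthonormal:
  assumes "orthonormal_family e r"
  shows "gram_mat e r = 1\<^sub>m r"
  by (rule eq_matI) (auto simp: gram_mat_def orthonormal_familyD[OF assms])

lemma det_gram_eq_det_coord:
  assumes "orthonormal_family e r" "\<And>i. i \<in> {1..r} \<Longrightarrow> x i \<in> span (e ` {1..r})"
  shows "Determinant.det (gram_mat x r) = (Determinant.det (coord_mat x e r))\<^sup>2"
  using det_gram_change_of_basis[of "\<lambda>x. x" r x e]
    orthonormal_family_expansion[OF assms(1) assms(2)]
  by (simp add: gram_mat_orthonormal[OF assms(1)] linear_ident)

text \<open>Adapted to the flag, the coordinate matrix is lower triangular, so its determinant is
  the product of the heights.\<close>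

lemma det_gram_triangular:
  assumes "orthonormal_family e r" "\<And>i. i \<in> {1..r} \<Longrightarrow> x i \<in> span (e ` {1..i})"
  shows "Determinant.det (gram_mat x r) = (\<Prod>i\<in>{1..r}. inner (x i) (e i))\<^sup>2"
proof -
  have sub: "x i \<in> span (e ` {1..r})" if "i \<in> {1..r}" for i
    using assms(2)[OF that] that span_mono[of "e ` {1..i}" "e ` {1..r}"] by force
  have zero: "inner (x i) (e j) = 0" if "i \<in> {1..r}" "j \<in> {1..r}" "i < j" for i j
  proof -
    have "Linear_Algebra.orthogonal (e j) (x i)"
    proof (rule orthogonal_to_span[OF assms(2)[OF that(1)]])
      fix y assume "y \<in> e ` {1..i}"
      then show "Linear_Algebra.orthogonal (e j) y"
        using that orthonormal_familyD[OF assms(1)] by (auto simp: Linear_Algebra.orthogonal_def)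
    qed
    then show ?thesis by (simp add: Linear_Algebra.orthogonal_def inner_commute)
  qed
  have "Determinant.det (coord_mat x e r) = prod_list (diag_mat (coord_mat x e r))"
    by (rule det_lower_triangular[where n=r]) (auto simp: coord_mat_def zero)
  also have "\<dots> = (\<Prod>i = 0..<r. inner (x (Suc i)) (e (Suc i)))"
    unfolding prod_list_diag_prod by (simp add: coord_mat_def)
  also have "\<dots> = (\<Prod>i\<in>{1..r}. inner (x i) (e i))"
    by (rule prod_Suc_lessThan_eq[where f="\<lambda>i. inner (x i) (e i)"])
  finally show ?thesis using det_gram_eq_det_coord[OF assms(1) sub] by simp
qed

text \<open>The coordinate matrix between two orthonormal bases of one subspace has squared
  determinant 1. So the distortion depends on the subspace only, and a convenient basis may be
  chosen.\<close>

lemma det_gram_orthonormal_cong: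
  assumes e: "orthonormal_family e r" and f: "orthonormal_family f r"
    and span: "span (e ` {1..r}) = span (f ` {1..r})" and M: "linear M"
  shows "Determinant.det (gram_mat (\<lambda>i. M (e i)) r) = Determinant.det (gram_mat (\<lambda>i. M (f i)) r)"
proof -
  have mem: "e i \<in> span (f ` {1..r})" if "i \<in> {1..r}" for i
    unfolding span[symmetric] using that by (simp add: span_base)
  have "(Determinant.det (coord_mat e f r))\<^sup>2 = 1"
    using det_gram_eq_det_coord[of f r e, OF f mem] gram_mat_orthonormal[OF e] by simp
  then show ?thesis
    using det_gram_change_of_basis[of M r e f, OF M orthonormal_family_expansion[OF f mem]] by simp
qed

section \<open>Gram-Schmidt\<close>

text \<open>The Gram-Schmidt vector before normalization. For an independent family its norm is the
  distance of \<open>v i\<close> from the span of the preceding vectors.\<close>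

definition gs_residual :: "(nat \<Rightarrow> 'a::euclidean_space) \<Rightarrow> nat \<Rightarrow> 'a" where
  "gs_residual v i = v i - (\<Sum>j\<in>{1..<i}. inner (v i) (gram_schmidt v j) *\<^sub>R gram_schmidt v j)"

lemma gram_schmidt_eq: "gram_schmidt v i = sgn (gs_residual v i)"
  by (subst gram_schmidt.simps) (simp add: gs_residual_def)

text \<open>A sequential form of independence, suited to induction along Gram-Schmidt. It also
  excludes repeated vectors, so that injectivity need not be carried along.\<close>

definition independent_family :: "(nat \<Rightarrow> 'a::euclidean_space) \<Rightarrow> nat \<Rightarrow> bool" where
  "independent_family v r \<longleftrightarrow> (\<forall>i\<in>{1..r}. v i \<notin> span (v ` {1..<i}))"

lemma independent_family_mono:
  "independent_family v r \<Longrightarrow> s \<le> r \<Longrightarrow> independent_family v s"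
  by (simp add: independent_family_def)

lemma independent_familyI:
  assumes "inj_on v {1..r}" "independent (v ` {1..r})"
  shows "independent_family v r"
  unfolding independent_family_def
proof (intro ballI notI)
  fix i assume i: "i \<in> {1..r}" "v i \<in> span (v ` {1..<i})"
  have "v j \<noteq> v i" if "j \<in> {1..<i}" for j
    using inj_onD[OF assms(1), of j i] i(1) that by auto
  then have "v ` {1..<i} \<subseteq> v ` {1..r} - {v i}"
    using i(1) by force
  then have "v i \<in> span (v ` {1..r} - {v i})"
    using i(2) span_mono[of "v ` {1..<i}" "v ` {1..r} - {v i}"] by blast
  then show False using assms(2) i(1) by (auto simp: dependent_def)
qed

lemma independent_family_linear_image:
  assumes "linear M" "inj M" "independent_family v r"
  shows "independent_family (\<lambda>i. M (v i)) r"
  unfolding independent_family_def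
proof (intro ballI notI)
  fix i assume i: "i \<in> {1..r}" "M (v i) \<in> span ((\<lambda>i. M (v i)) ` {1..<i})"
  have "span ((\<lambda>i. M (v i)) ` {1..<i}) = M ` span (v ` {1..<i})"
    by (simp add: linear_span_image[OF assms(1), symmetric] image_image)
  then have "v i \<in> span (v ` {1..<i})"
    using i(2) assms(2) by (auto simp: inj_def)
  then show False using assms(3) i(1) by (auto simp: independent_family_def)
qed

lemma orthonormal_family_imp_independent_family:
  "orthonormal_family e r \<Longrightarrow> independent_family e r"
  by (rule independent_familyI[OF orthonormal_family_inj_on orthonormal_family_independent])

text \<open>The three claims need a joint induction: the equality of spans for \<open>r\<close>
  shows that the next residual is nonzero, and this makes the next vector a unit vector. The last
  claim splits \<open>v i\<close> into its residual and a part orthogonal to the new vector.\<close>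

lemma gram_schmidt_properties:
  assumes "independent_family v r"
  shows "orthonormal_family (gram_schmidt v) r
    \<and> span (gram_schmidt v ` {1..r}) = span (v ` {1..r})
    \<and> (\<forall>i\<in>{1..r}. gs_residual v i \<noteq> 0 \<and> inner (v i) (gram_schmidt v i) = norm (gs_residual v i))"
  using assms
proof (induction r)
  case 0
  then show ?case by (simp add: orthonormal_family_def)
next
  case (Suc r)
  let ?e = "gram_schmidt v" and ?w = "gs_residual v (Suc r)"
  have IH: "orthonormal_family ?e r" "span (?e ` {1..r}) = span (v ` {1..r})"
    "\<forall>i\<in>{1..r}. gs_residual v i \<noteq> 0 \<and> inner (v i) (?e i) = norm (gs_residual v i)"
    using Suc.IH independent_family_mono[OF Suc.prems, of r] by auto
  define p where "p = (\<Sum>j\<in>{1..r}. inner (v (Suc r)) (?e j) *\<^sub>R ?e j)"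
  have p: "p \<in> span (?e ` {1..r})"
    unfolding p_def by (intro span_sum span_scale) (auto intro: span_base)
  have w: "?w = v (Suc r) - p"
    by (simp add: gs_residual_def p_def atLeastLessThanSuc_atLeastAtMost)
  have "v (Suc r) \<notin> span (v ` {1..r})"
    using Suc.prems unfolding independent_family_def
    by (metis atLeastLessThanSuc_atLeastAtMost atLeastAtMost_iff le_add1 order_refl plus_1_eq_Suc)
  then have w0: "?w \<noteq> 0" unfolding w using p IH(2) by auto
  have perp: "inner ?w (?e j) = 0" if "j \<in> {1..r}" for j
    using orthonormal_family_inner_sum[OF IH(1) that subset_refl] that
    by (simp add: w p_def inner_diff_left)
  have e: "?e (Suc r) = ?w /\<^sub>R norm ?w" by (simp add: gram_schmidt_eq sgn_div_norm)
  have perp': "inner (?e (Suc r)) (?e j) = 0" if "j \<in> {1..r}" for j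
    using perp[OF that] by (simp add: e)
  have one: "inner (?e (Suc r)) (?e (Suc r)) = 1"
    using w0 by (simp add: gram_schmidt_eq norm_sgn flip: norm_eq_1)
  have on: "orthonormal_family ?e (Suc r)"
    unfolding orthonormal_family_def
  proof (intro ballI)
    fix i j assume "i \<in> {1..Suc r}" "j \<in> {1..Suc r}"
    then consider "i \<in> {1..r}" "j \<in> {1..r}" | "i = Suc r" "j \<in> {1..r}" | "i \<in> {1..r}" "j = Suc r"
      | "i = Suc r" "j = Suc r" by force
    then show "inner (?e i) (?e j) = (if i = j then 1 else 0)"
      using orthonormal_familyD[OF IH(1)] perp' one by cases (auto simp: inner_commute)
  qed
  have v: "v (Suc r) = norm ?w *\<^sub>R ?e (Suc r) + p" using w0 by (simp add: e w)
  have "inner p (?e (Suc r)) = 0"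
  proof -
    have "Linear_Algebra.orthogonal (?e (Suc r)) p"
      by (rule orthogonal_to_span[OF p]) (use perp' in \<open>auto simp: Linear_Algebra.orthogonal_def\<close>)
    then show ?thesis by (simp add: Linear_Algebra.orthogonal_def inner_commute)
  qed
  then have iv: "inner (v (Suc r)) (?e (Suc r)) = norm ?w"
    using arg_cong[OF v, of "\<lambda>x. inner x (?e (Suc r))"] one by (simp add: inner_add_left)
  have ins: "f ` {1..Suc r} = insert (f (Suc r)) (f ` {1..r})" for f :: "nat \<Rightarrow> 'a"
    by (simp add: atLeastAtMostSuc_conv)
  have "span (?e ` {1..Suc r}) = span (v ` {1..Suc r})"
  proof -
    have e_old: "span (?e ` {1..r}) \<subseteq> span (?e ` {1..Suc r})"
      and v_old: "span (v ` {1..r}) \<subseteq> span (v ` {1..Suc r})"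
      by (rule span_mono, force)+
    have "v (Suc r) \<in> span (?e ` {1..Suc r})"
      by (subst v, intro span_add span_scale) (use p e_old in \<open>auto intro: span_base\<close>)
    moreover have "?e (Suc r) \<in> span (v ` {1..Suc r})"
      unfolding e w by (intro span_scale span_diff) (use p v_old IH(2) in \<open>auto intro: span_base\<close>)
    moreover have "?e ` {1..r} \<subseteq> span (v ` {1..Suc r})"
      by (rule order_trans[OF span_superset]) (use IH(2) v_old in simp)
    moreover have "v ` {1..r} \<subseteq> span (?e ` {1..Suc r})"
      by (rule order_trans[OF span_superset]) (use IH(2) e_old in simp)
    ultimately show ?thesis
      unfolding span_eq ins by simp
  qed
  moreover have "\<forall>i\<in>{1..Suc r}. gs_residual v i \<noteq> 0 \<and> inner (v i) (?e i) = norm (gs_residual v i)"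
    using IH(3) w0 iv by (auto simp: le_Suc_eq)
  ultimately show ?case using on by blast
qed

lemma gram_schmidt_span:
  assumes "independent_family v r" "i \<le> r"
  shows "span (gram_schmidt v ` {1..i}) = span (v ` {1..i})"
  using gram_schmidt_properties[OF independent_family_mono[OF assms]] by blast

lemma det_gram_gram_schmidt:
  assumes "independent_family v r"
  shows "Determinant.det (gram_mat v r) = (\<Prod>i\<in>{1..r}. inner (v i) (gram_schmidt v i))\<^sup>2"
proof (rule det_gram_triangular)
  show "orthonormal_family (gram_schmidt v) r" using gram_schmidt_properties[OF assms] by blast
  show "v i \<in> span (gram_schmidt v ` {1..i})" if "i \<in> {1..r}" for i
    using that gram_schmidt_span[OF assms, of i] span_base[of "v i" "v ` {1..i}"] by simp
qed

section \<open>Volumes under linear maps\<close>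

text \<open>One step of Hadamard's inequality: the new factor of the volume is the height of the
  last vector, which is at most its length.\<close>

lemma det_gram_Suc_le:
  assumes "independent_family v (Suc r)"
  shows "Determinant.det (gram_mat v (Suc r)) \<le> Determinant.det (gram_mat v r) * (norm (v (Suc r)))\<^sup>2"
proof -
  let ?g = "gram_schmidt v (Suc r)"
  have "orthonormal_family (gram_schmidt v) (Suc r)"
    using gram_schmidt_properties[OF assms] by blast
  then have "norm ?g = 1" by (simp add: orthonormal_family_def norm_eq_1)
  then have "(inner (v (Suc r)) ?g)\<^sup>2 \<le> (norm (v (Suc r)))\<^sup>2"
    using Cauchy_Schwarz_ineq2[of "v (Suc r)" ?g] by (metis abs_le_square_iff abs_norm_cancel mult.right_neutral)
  then show ?thesis
    using det_gram_gram_schmidt[OF assms] det_gram_gram_schmidt[OF independent_family_mono[OF assms, of r]]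
    by (simp add: power_mult_distrib mult_left_mono)
qed

text \<open>Some unit vector of the span is orthogonal to the first \<open>r\<close> vectors \<open>u\<close>. Taking it as the last
  member of an orthonormal basis of the span reduces the dimension by one.\<close>

lemma det_gram_le_prod:
  assumes M: "linear M" "inj M"
    and \<tau>: "\<And>k x. k \<in> {1..r} \<Longrightarrow> (\<forall>j\<in>{1..<k}. inner x (u j) = 0) \<Longrightarrow> norm (M x) \<le> \<tau> k * norm x"
    and e: "orthonormal_family e r"
  shows "Determinant.det (gram_mat (\<lambda>i. M (e i)) r) \<le> (\<Prod>k\<in>{1..r}. \<tau> k)\<^sup>2"
  using \<tau> e
proof (induction r arbitrary: e)
  case 0
  then show ?case using gram_mat_orthonormal[of "\<lambda>i. M (e i)" 0]
    by (simp add: orthonormal_family_def)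
next
  case (Suc r)
  define S where "S = span (e ` {1..Suc r})"
  have S: "subspace S" "dim S = Suc r"
    unfolding S_def using orthonormal_family_dim_span[OF Suc.prems(2)] by auto
  \<comment> \<open>A vector \<open>z\<close> of \<open>S\<close> orthogonal to u_1, ..., u_r is
    exactly one to which the bound with constant \<open>\<tau> (Suc r)\<close> applies.\<close>
  have "card (u ` {1..r}) < dim S"
    using card_image_le[of "{1..r}" u] S(2) by simp
  then obtain z where z: "z \<in> S" "norm z = 1" "\<And>y. y \<in> u ` {1..r} \<Longrightarrow> inner z y = 0"
    using subspace_meets_orthogonal_complement[OF S(1), of "u ` {1..r}"] by blast
  define T where "T = {y \<in> S. \<forall>x\<in>span {z}. Linear_Algebra.orthogonal x y}"
  have sub: "span {z} \<subseteq> S" using z(1) S(1) by (simp add: span_minimal)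
  have "dim T + dim (span {z}) = dim S"
    unfolding T_def by (rule dim_subspace_orthogonal_to_vectors) (use S sub in auto)
  moreover have "dim (span {z}) = 1" using z(2) by auto
  ultimately have T: "dim T = r" using S(2) by simp
  have sT: "subspace T"
  proof -
    have "T = S \<inter> {y. \<forall>x\<in>span {z}. Linear_Algebra.orthogonal x y}" by (auto simp: T_def)
    then show ?thesis
      using subspace_inter[OF S(1) subspace_orthogonal_to_vectors[of "span {z}"]] by simp
  qed
  obtain g where g: "orthonormal_family g r" "span (g ` {1..r}) = T"
    by (rule orthonormal_family_of_subspace[OF sT, unfolded T])
  define f where "f = g(Suc r := z)"
  have gz: "inner (g i) z = 0" if "i \<in> {1..r}" for i
  proof -
    have "g i \<in> T" unfolding g(2)[symmetric] by (rule span_base) (use that in simp)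
    then show ?thesis using span_base[of z "{z}"] by (auto simp: T_def Linear_Algebra.orthogonal_def inner_commute)
  qed
  have f: "orthonormal_family f (Suc r)"
    unfolding orthonormal_family_def
  proof (intro ballI)
    fix i j assume "i \<in> {1..Suc r}" "j \<in> {1..Suc r}"
    then consider "i \<in> {1..r}" "j \<in> {1..r}" | "i = Suc r" "j \<in> {1..r}" | "i \<in> {1..r}" "j = Suc r"
      | "i = Suc r" "j = Suc r" by force
    then show "inner (f i) (f j) = (if i = j then 1 else 0)"
      using orthonormal_familyD[OF g(1)] gz z(2)
      by cases (auto simp: f_def inner_commute norm_eq_1)
  qed
  have fS: "span (f ` {1..Suc r}) = S"
  proof (rule subspace_dim_equal)
    have "f ` {1..Suc r} \<subseteq> S"
    proof -
      have "g ` {1..r} \<subseteq> S" using g(2) span_superset[of "g ` {1..r}"] by (auto simp: T_def)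
      then show ?thesis using z(1) by (auto simp: f_def)
    qed
    then show "span (f ` {1..Suc r}) \<subseteq> S" using S(1) by (rule span_minimal)
    show "dim S \<le> dim (span (f ` {1..Suc r}))"
      using orthonormal_family_dim_span[OF f] S(2) by simp
  qed (use S(1) in auto)
  have ind: "independent_family (\<lambda>i. M (f i)) (Suc r)"
    by (rule independent_family_linear_image[OF M orthonormal_family_imp_independent_family[OF f]])
  have Mz: "norm (M (f (Suc r))) \<le> \<tau> (Suc r)"
    using Suc.prems(1)[of "Suc r" z] z by (simp add: f_def)
  \<comment> \<open>Both families span \<open>S\<close>, so \<open>e\<close> may be exchanged for
    \<open>f\<close>, whose last vector is \<open>z\<close>.\<close>
  have "Determinant.det (gram_mat (\<lambda>i. M (e i)) (Suc r)) = Determinant.det (gram_mat (\<lambda>i. M (f i)) (Suc r))"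
    by (rule det_gram_orthonormal_cong[OF Suc.prems(2) f _ M(1)]) (simp only: fS S_def)
  also have "\<dots> \<le> Determinant.det (gram_mat (\<lambda>i. M (f i)) r) * (norm (M (f (Suc r))))\<^sup>2"
    by (rule det_gram_Suc_le[OF ind])
  also have "\<dots> \<le> (\<Prod>k\<in>{1..r}. \<tau> k)\<^sup>2 * (\<tau> (Suc r))\<^sup>2"
  proof (rule mult_mono)
    show "Determinant.det (gram_mat (\<lambda>i. M (f i)) r) \<le> (\<Prod>k\<in>{1..r}. \<tau> k)\<^sup>2"
      by (rule Suc.IH) (use Suc.prems(1) orthonormal_family_mono[OF f] in auto)
    show "(norm (M (f (Suc r))))\<^sup>2 \<le> (\<tau> (Suc r))\<^sup>2"
      using Mz by (simp add: power_mono)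
  qed auto
  finally show ?case by (simp add: power_mult_distrib)
qed

text \<open>Up to sign the two products are the volumes of \<open>M x\<close> and of
  \<open>x\<close>, read off in orthonormal families adapted to the two flags. The Gram determinants
  give the inequality between squares. The map enters only through the constants
  \<open>\<tau>\<close>, so that the lemma can be used for \<open>L\<close> and for its
  inverse.\<close>

lemma triangular_prod_le:
  assumes M: "linear M" "inj M"
    and \<tau>: "\<And>k x. k \<in> {1..r} \<Longrightarrow> (\<forall>j\<in>{1..<k}. inner x (u j) = 0) \<Longrightarrow> norm (M x) \<le> \<tau> k * norm x"
    and \<tau>_nonneg: "\<And>k. k \<in> {1..r} \<Longrightarrow> 0 \<le> \<tau> k"
    and e: "orthonormal_family e r" "\<And>i. i \<in> {1..r} \<Longrightarrow> x i \<in> span (e ` {1..i})"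
    and f: "orthonormal_family f r" "\<And>i. i \<in> {1..r} \<Longrightarrow> M (x i) \<in> span (f ` {1..i})"
  shows "\<bar>\<Prod>i\<in>{1..r}. inner (M (x i)) (f i)\<bar> \<le> (\<Prod>k\<in>{1..r}. \<tau> k) * \<bar>\<Prod>i\<in>{1..r}. inner (x i) (e i)\<bar>"
proof -
  have mem: "x i \<in> span (e ` {1..r})" if "i \<in> {1..r}" for i
    using e(2)[OF that] that span_mono[of "e ` {1..i}" "e ` {1..r}"] by force
  have "(\<Prod>i\<in>{1..r}. inner (M (x i)) (f i))\<^sup>2 = Determinant.det (gram_mat (\<lambda>i. M (x i)) r)"
    by (rule det_gram_triangular[OF f, symmetric])
  also have "\<dots> = (Determinant.det (coord_mat x e r))\<^sup>2 * Determinant.det (gram_mat (\<lambda>i. M (e i)) r)"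
    by (rule det_gram_change_of_basis[OF M(1) orthonormal_family_expansion[OF e(1) mem]])
  also have "\<dots> \<le> (Determinant.det (coord_mat x e r))\<^sup>2 * (\<Prod>k\<in>{1..r}. \<tau> k)\<^sup>2"
    by (rule mult_left_mono[OF det_gram_le_prod[OF M \<tau> e(1)]]) auto
  also have "(Determinant.det (coord_mat x e r))\<^sup>2 = Determinant.det (gram_mat x r)"
    by (rule det_gram_eq_det_coord[OF e(1) mem, symmetric])
  also have "\<dots> = (\<Prod>i\<in>{1..r}. inner (x i) (e i))\<^sup>2"
    by (rule det_gram_triangular[OF e])
  finally have "\<bar>\<Prod>i\<in>{1..r}. inner (M (x i)) (f i)\<bar>
      \<le> \<bar>(\<Prod>i\<in>{1..r}. inner (x i) (e i)) * (\<Prod>k\<in>{1..r}. \<tau> k)\<bar>"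
    by (simp add: abs_le_square_iff power_mult_distrib)
  then show ?thesis
    using prod_nonneg[of "{1..r}" \<tau>] \<tau>_nonneg by (simp add: abs_mult mult.commute)
qed

section \<open>Singular vectors\<close>

lemma subspace_gram_eigenspace:
  fixes L :: "'a::euclidean_space \<Rightarrow> 'a"
  assumes "linear L"
  shows "subspace {x. adjoint L (L x) = s\<^sup>2 *\<^sub>R x}"
  using assms adjoint_linear[OF assms]
  by (auto simp: subspace_def linear_add linear_scale linear_0 scaleR_add_right)

text \<open>This makes eigenvectors to different singular values orthogonal, and it translates
  orthogonality to \<open>L y\<close> into orthogonality to \<open>y\<close> when s is
  nonzero.\<close>

lemma inner_image_gram_eigenvector:
  fixes L :: "'a::euclidean_space \<Rightarrow> 'a"
  assumes "linear L" "adjoint L (L y) = s\<^sup>2 *\<^sub>R y"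
  shows "inner (L x) (L y) = s\<^sup>2 * inner x y"
  using adjoint_works[OF assms(1), of x "L y"] assms(2) by simp

text \<open>No diagonalization is carried out: the multiplicities in \<open>singular_values\<close>
  already say that the dimensions of the eigenspaces add up to n. It remains to take an orthonormal
  basis of each eigenspace and to number the vectors so that index i belongs to the value
  \<open>\<sigma> i\<close>.\<close>

lemma singular_basis_exists:
  fixes L :: "'a::euclidean_space \<Rightarrow> 'a"
  assumes L: "linear L" and \<sigma>: "singular_values L \<sigma>"
  obtains u where "orthonormal_family u DIM('a)"
    "\<And>i. i \<in> {1..DIM('a)} \<Longrightarrow> adjoint L (L (u i)) = (\<sigma> i)\<^sup>2 *\<^sub>R u i"
proof -
  define E where "E s = {x. adjoint L (L x) = s\<^sup>2 *\<^sub>R x}" for s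
  define I where "I s = {i \<in> {1..DIM('a)}. \<sigma> i = s}" for s
  have card: "card (I s) = dim (E s)" if "s \<ge> 0" for s
    using \<sigma> that by (auto simp: singular_values_def E_def I_def)
  have nonneg: "\<sigma> i \<ge> 0" if "i \<in> {1..DIM('a)}" for i
    using \<sigma> that by (auto simp: singular_values_def)
  have "\<exists>e. orthonormal_family e (dim (E s)) \<and> span (e ` {1..dim (E s)}) = E s" for s
  proof -
    have "subspace (E s)" unfolding E_def by (rule subspace_gram_eigenspace[OF L])
    then obtain e where "orthonormal_family e (dim (E s))" "span (e ` {1..dim (E s)}) = E s"
      by (rule orthonormal_family_of_subspace)
    then show ?thesis by blast
  qed
  then obtain b where b: "\<And>s. orthonormal_family (b s) (dim (E s))"
      "\<And>s. span (b s ` {1..dim (E s)}) = E s"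
    by metis
  \<comment> \<open>\<open>h s\<close> distributes the basis of \<open>E s\<close> over the indices
    at which \<sigma> takes the value s.\<close>
  have "\<exists>h. bij_betw h (I s) {1..dim (E s)}" if "s \<ge> 0" for s
    using card[OF that] by (intro finite_same_card_bij) (auto simp: I_def)
  then obtain h where h: "\<And>s. s \<ge> 0 \<Longrightarrow> bij_betw (h s) (I s) {1..dim (E s)}"
    by metis
  define u where "u i = b (\<sigma> i) (h (\<sigma> i) i)" for i
  have h_mem: "h (\<sigma> i) i \<in> {1..dim (E (\<sigma> i))}" if "i \<in> {1..DIM('a)}" for i
    using bij_betwE[OF h[OF nonneg[OF that]]] that by (auto simp: I_def)
  have uE: "u i \<in> E (\<sigma> i)" if "i \<in> {1..DIM('a)}" for i
  proof -
    have "u i \<in> span (b (\<sigma> i) ` {1..dim (E (\<sigma> i))})"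
      unfolding u_def by (rule span_base, rule imageI, rule h_mem[OF that])
    then show ?thesis by (simp only: b(2))
  qed
  have eig: "adjoint L (L (u i)) = (\<sigma> i)\<^sup>2 *\<^sub>R u i" if "i \<in> {1..DIM('a)}" for i
    using uE[OF that] by (simp add: E_def)
  have "orthonormal_family u DIM('a)"
    unfolding orthonormal_family_def
  proof (intro ballI)
    fix i j assume ij: "i \<in> {1..DIM('a)}" "j \<in> {1..DIM('a)}"
    show "inner (u i) (u j) = (if i = j then 1 else 0)"
    proof (cases "\<sigma> i = \<sigma> j")
      case True
      have "inner (u i) (u j) = (if h (\<sigma> i) i = h (\<sigma> i) j then 1 else 0)"
        unfolding u_def True[symmetric]
        using orthonormal_familyD[OF b(1) h_mem[OF ij(1)], of "h (\<sigma> i) j"] h_mem[OF ij(2)] True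
        by simp
      moreover have "h (\<sigma> i) i = h (\<sigma> i) j \<longleftrightarrow> i = j"
        using h[OF nonneg[OF ij(1)]] ij True by (auto simp: bij_betw_def inj_on_def I_def)
      ultimately show ?thesis by simp
    next
      case False
      have "(\<sigma> i)\<^sup>2 * inner (u i) (u j) = (\<sigma> j)\<^sup>2 * inner (u i) (u j)"
        using inner_image_gram_eigenvector[OF L eig[OF ij(1)], of "u j"]
          inner_image_gram_eigenvector[OF L eig[OF ij(2)], of "u i"]
        by (auto simp: inner_commute)
      \<comment> \<open>Different nonnegative numbers have different squares; the eigenvalues are
        the squares.\<close>
      moreover have "(\<sigma> i)\<^sup>2 \<noteq> (\<sigma> j)\<^sup>2"
        using False nonneg[OF ij(1)] nonneg[OF ij(2)] by (simp add: power2_eq_iff_nonneg)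
      ultimately show ?thesis using False by auto
    qed
  qed
  then show thesis using that eig by blast
qed

lemma orthonormal_family_complete:
  fixes u :: "nat \<Rightarrow> 'a::euclidean_space"
  assumes "orthonormal_family u DIM('a)"
  shows "x = (\<Sum>i\<in>{1..DIM('a)}. inner x (u i) *\<^sub>R u i)"
proof (rule orthonormal_family_expansion[OF assms])
  have "span (u ` {1..DIM('a)}) = UNIV"
    using orthonormal_family_dim_span[OF assms] by (metis dim_eq_full span_span)
  then show "x \<in> span (u ` {1..DIM('a)})" by simp
qed

lemma norm_image_singular_basis:
  fixes L :: "'a::euclidean_space \<Rightarrow> 'a"
  assumes L: "linear L" and u: "orthonormal_family u DIM('a)"
    and eig: "\<And>i. i \<in> {1..DIM('a)} \<Longrightarrow> adjoint L (L (u i)) = (\<sigma> i)\<^sup>2 *\<^sub>R u i"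
  shows "(norm (L x))\<^sup>2 = (\<Sum>i\<in>{1..DIM('a)}. (\<sigma> i)\<^sup>2 * (inner x (u i))\<^sup>2)"
    and "(norm x)\<^sup>2 = (\<Sum>i\<in>{1..DIM('a)}. (inner x (u i))\<^sup>2)"
proof -
  let ?s = "\<Sum>i\<in>{1..DIM('a)}. inner x (u i) *\<^sub>R u i"
  have x: "x = ?s" by (rule orthonormal_family_complete[OF u])
  have "(norm x)\<^sup>2 = inner x ?s" using x by (simp add: power2_norm_eq_inner)
  then show "(norm x)\<^sup>2 = (\<Sum>i\<in>{1..DIM('a)}. (inner x (u i))\<^sup>2)"
    by (simp add: inner_sum_right power2_eq_square)
  have "L x = (\<Sum>i\<in>{1..DIM('a)}. inner x (u i) *\<^sub>R L (u i))"
    using arg_cong[OF x, of L] by (simp add: linear_sum[OF L] linear_scale[OF L])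
  then have "(norm (L x))\<^sup>2 = inner (L x) (\<Sum>i\<in>{1..DIM('a)}. inner x (u i) *\<^sub>R L (u i))"
    by (simp add: power2_norm_eq_inner)
  also have "\<dots> = (\<Sum>i\<in>{1..DIM('a)}. inner x (u i) * inner (L x) (L (u i)))"
    by (simp add: inner_sum_right)
  also have "\<dots> = (\<Sum>i\<in>{1..DIM('a)}. (\<sigma> i)\<^sup>2 * (inner x (u i))\<^sup>2)"
    by (rule sum.cong)
      (auto simp: inner_image_gram_eigenvector[OF L eig] power2_eq_square)
  finally show "(norm (L x))\<^sup>2 = (\<Sum>i\<in>{1..DIM('a)}. (\<sigma> i)\<^sup>2 * (inner x (u i))\<^sup>2)" .
qed

text \<open>\<open>\<sigma> i\<close> is the length of the image of a unit singular vector, which is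
  nonzero by injectivity.\<close>

lemma singular_values_pos:
  fixes L :: "'a::euclidean_space \<Rightarrow> 'a"
  assumes L: "linear L" "inj L" and \<sigma>: "singular_values L \<sigma>" and i: "i \<in> {1..DIM('a)}"
  shows "\<sigma> i > 0"
proof -
  obtain u where u: "orthonormal_family u DIM('a)"
    "\<And>i. i \<in> {1..DIM('a)} \<Longrightarrow> adjoint L (L (u i)) = (\<sigma> i)\<^sup>2 *\<^sub>R u i"
    using singular_basis_exists[OF L(1) \<sigma>] by blast
  have 1: "inner (u i) (u i) = 1" using orthonormal_familyD[OF u(1) i i] by simp
  then have "L (u i) \<noteq> 0"
    using L linear_injective_0[OF L(1)] by auto
  moreover have "inner (L (u i)) (L (u i)) = (\<sigma> i)\<^sup>2"
    using inner_image_gram_eigenvector[OF L(1) u(2)[OF i]] 1 by simp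
  ultimately have "\<sigma> i \<noteq> 0" by auto
  then show ?thesis using \<sigma> i by (auto simp: singular_values_def less_le)
qed

text \<open>The lower bound is the upper bound for the inverse of \<open>L\<close>, with the singular vectors \<open>L u\<^sub>n, \<dots>, L u\<^sub>1\<close>.\<close>

lemma triangular_prod_singular_bounds:
  fixes L :: "'a::euclidean_space \<Rightarrow> 'a"
  assumes L: "linear L" "bij L" and \<sigma>: "singular_values L \<sigma>" and r: "r \<le> DIM('a)"
    and e: "orthonormal_family e r" "\<And>i. i \<in> {1..r} \<Longrightarrow> x i \<in> span (e ` {1..i})"
    and f: "orthonormal_family f r" "\<And>i. i \<in> {1..r} \<Longrightarrow> L (x i) \<in> span (f ` {1..i})"
  shows "\<bar>\<Prod>i\<in>{1..r}. inner (L (x i)) (f i)\<bar> \<le> (\<Prod>i\<in>{1..r}. \<sigma> i) * \<bar>\<Prod>i\<in>{1..r}. inner (x i) (e i)\<bar>"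
    and "(\<Prod>i\<in>{DIM('a)-r+1..DIM('a)}. \<sigma> i) * \<bar>\<Prod>i\<in>{1..r}. inner (x i) (e i)\<bar>
      \<le> \<bar>\<Prod>i\<in>{1..r}. inner (L (x i)) (f i)\<bar>"
proof -
  let ?n = "DIM('a)"
  have inj: "inj L" and surj: "surj L" using L(2) by (auto simp: bij_def)
  obtain u where u: "orthonormal_family u ?n"
    "\<And>i. i \<in> {1..?n} \<Longrightarrow> adjoint L (L (u i)) = (\<sigma> i)\<^sup>2 *\<^sub>R u i"
    using singular_basis_exists[OF L(1) \<sigma>] by blast
  have norms: "(norm (L y))\<^sup>2 = (\<Sum>i\<in>{1..?n}. (\<sigma> i)\<^sup>2 * (inner y (u i))\<^sup>2)"
    "(norm y)\<^sup>2 = (\<Sum>i\<in>{1..?n}. (inner y (u i))\<^sup>2)" for y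
    using norm_image_singular_basis[OF L(1) u] by blast+
  have pos: "\<sigma> i > 0" if "i \<in> {1..?n}" for i
    using singular_values_pos[OF L(1) inj \<sigma> that] .
  have decr: "\<sigma> j \<le> \<sigma> i" if "i \<in> {1..?n}" "j \<in> {1..?n}" "i \<le> j" for i j
    using \<sigma> that by (auto simp: singular_values_def)
  show "\<bar>\<Prod>i\<in>{1..r}. inner (L (x i)) (f i)\<bar> \<le> (\<Prod>i\<in>{1..r}. \<sigma> i) * \<bar>\<Prod>i\<in>{1..r}. inner (x i) (e i)\<bar>"
  proof (rule triangular_prod_le[OF L(1) inj, where u=u, OF _ _ e f])
    fix k x assume k: "k \<in> {1..r}" and perp: "\<forall>j\<in>{1..<k}. inner x (u j) = 0"
    have "(norm (L x))\<^sup>2 = (\<Sum>i\<in>{1..?n}. (\<sigma> i)\<^sup>2 * (inner x (u i))\<^sup>2)"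
      by (rule norms(1))
    \<comment> \<open>The terms with i < k vanish by orthogonality, and for the others
      \<open>\<sigma> i\<close> is at most \<open>\<sigma> k\<close>.\<close>
    also have "\<dots> \<le> (\<Sum>i\<in>{1..?n}. (\<sigma> k)\<^sup>2 * (inner x (u i))\<^sup>2)"
    proof (rule sum_mono)
      fix i assume i: "i \<in> {1..?n}"
      show "(\<sigma> i)\<^sup>2 * (inner x (u i))\<^sup>2 \<le> (\<sigma> k)\<^sup>2 * (inner x (u i))\<^sup>2"
      proof (cases "i < k")
        case True
        then show ?thesis using perp i by simp
      next
        case False
        then have "\<sigma> i \<le> \<sigma> k" using decr[of k i] k i r by auto
        then show ?thesis using pos[OF i] by (intro mult_right_mono power_mono) auto
      qed
    qed
    also have "\<dots> = (\<sigma> k * norm x)\<^sup>2"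
      by (simp add: norms(2) power_mult_distrib sum_distrib_left)
    finally show "norm (L x) \<le> \<sigma> k * norm x"
      by (rule power2_le_imp_le) (use pos[of k] k r in simp)
  next
    show "0 \<le> \<sigma> k" if "k \<in> {1..r}" for k using pos[of k] that r by simp
  qed
  let ?M = "inv_into UNIV L"
  have inv_left: "?M (L y) = y" for y using inj by simp
  have inv_right: "L (?M y) = y" for y using surj by (simp add: surj_f_inv_f)
  have M: "linear ?M" using L(1) inj by (rule inj_linear_imp_inv_linear)
  have injM: "inj ?M" using surj by (rule surj_imp_inj_inv)
  have "\<bar>\<Prod>i\<in>{1..r}. inner (?M (L (x i))) (e i)\<bar>
      \<le> (\<Prod>k\<in>{1..r}. 1 / \<sigma> (?n + 1 - k)) * \<bar>\<Prod>i\<in>{1..r}. inner (L (x i)) (f i)\<bar>"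
  \<comment> \<open>The inverse takes \<open>L (x i)\<close> back to \<open>x i\<close>, so
    \<open>e\<close> and \<open>f\<close> change places. Its k-th largest singular value is 1 over
    the k-th smallest one of \<open>L\<close>, hence the index n + 1 - k.\<close>
  proof (rule triangular_prod_le[OF M injM, where u="\<lambda>j. L (u (?n + 1 - j))", OF _ _ f(1) f(2) e(1)])
    fix k y assume k: "k \<in> {1..r}" and perp: "\<forall>j\<in>{1..<k}. inner y (L (u (?n + 1 - j))) = 0"
    define z where "z = ?M y"
    have y: "y = L z" by (simp add: z_def inv_right)
    define m where "m = ?n + 1 - k"
    have m: "m \<in> {1..?n}" using k r by (auto simp: m_def)
    have "(\<sigma> m * norm z)\<^sup>2 = (\<Sum>i\<in>{1..?n}. (\<sigma> m)\<^sup>2 * (inner z (u i))\<^sup>2)"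
      by (simp add: norms(2) power_mult_distrib sum_distrib_left)
    also have "\<dots> \<le> (\<Sum>i\<in>{1..?n}. (\<sigma> i)\<^sup>2 * (inner z (u i))\<^sup>2)"
    proof (rule sum_mono)
      fix i assume i: "i \<in> {1..?n}"
      show "(\<sigma> m)\<^sup>2 * (inner z (u i))\<^sup>2 \<le> (\<sigma> i)\<^sup>2 * (inner z (u i))\<^sup>2"
      proof (cases "m < i")
        case True
        then have "?n + 1 - i \<in> {1..<k}"
          using i k r unfolding m_def atLeastLessThan_iff atLeastAtMost_iff by linarith
        then have "inner y (L (u i)) = 0"
          using perp[rule_format, of "?n + 1 - i"] i by simp
        \<comment> \<open>Orthogonality of \<open>L z\<close> to \<open>L (u i)\<close> passes to
          \<open>z\<close> and \<open>u i\<close> because \<open>\<sigma> i\<close> is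
          nonzero.\<close>
        then have "inner z (u i) = 0"
          using inner_image_gram_eigenvector[OF L(1) u(2)[OF i], of z] pos[OF i] by (simp add: y)
        then show ?thesis by simp
      next
        case False
        then have "\<sigma> m \<le> \<sigma> i" using decr[of i m] m i by auto
        then show ?thesis using pos[OF m] by (intro mult_right_mono power_mono) auto
      qed
    qed
    also have "\<dots> = (norm y)\<^sup>2"
      unfolding y by (rule norms(1)[symmetric])
    finally have "\<sigma> m * norm z \<le> norm y"
      by (rule power2_le_imp_le) simp
    then show "norm (?M y) \<le> 1 / \<sigma> (?n + 1 - k) * norm y"
      using pos[OF m] by (simp add: z_def m_def field_simps)
  next
    show "0 \<le> 1 / \<sigma> (?n + 1 - k)" if "k \<in> {1..r}" for k
    proof -
      have "?n + 1 - k \<in> {1..?n}" using that r by auto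
      then show ?thesis using pos[of "?n + 1 - k"] by simp
    qed
    show "?M (L (x i)) \<in> span (e ` {1..i})" if "i \<in> {1..r}" for i
      using e(2)[OF that] by (simp add: inv_left)
  qed
  moreover have "(\<Prod>k\<in>{1..r}. 1 / \<sigma> (?n + 1 - k)) = 1 / (\<Prod>i\<in>{?n-r+1..?n}. \<sigma> i)"
  proof -
    have "(\<Prod>k\<in>{1..r}. \<sigma> (?n + 1 - k)) = (\<Prod>i\<in>{?n-r+1..?n}. \<sigma> i)"
      by (rule prod.reindex_bij_witness[where i="\<lambda>k. ?n + 1 - k" and j="\<lambda>k. ?n + 1 - k"])
        (use r in auto)
    then show ?thesis by (simp add: prod_dividef)
  qed
  moreover have "(\<Prod>i\<in>{?n-r+1..?n}. \<sigma> i) > 0"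
    by (rule prod_pos) (use pos r in auto)
  ultimately show "(\<Prod>i\<in>{?n-r+1..?n}. \<sigma> i) * \<bar>\<Prod>i\<in>{1..r}. inner (x i) (e i)\<bar>
      \<le> \<bar>\<Prod>i\<in>{1..r}. inner (L (x i)) (f i)\<bar>"
    by (simp add: inv_left field_simps)
qed

section \<open>Orientation and the last frame vector\<close>

lemma orthonormal_list_iff_family:
  "orthonormal_list vs \<longleftrightarrow> orthonormal_family (\<lambda>i. vs ! (i - 1)) (length vs)"
proof
  assume "orthonormal_list vs"
  then show "orthonormal_family (\<lambda>i. vs ! (i - 1)) (length vs)"
    by (auto simp: orthonormal_list_def orthonormal_family_def)
next
  assume *: "orthonormal_family (\<lambda>i. vs ! (i - 1)) (length vs)"
  show "orthonormal_list vs"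
    unfolding orthonormal_list_def
  proof (intro allI impI)
    fix i j assume "i < length vs" "j < length vs"
    then show "inner (vs ! i) (vs ! j) = (if i = j then 1 else 0)"
      using orthonormal_familyD[OF *, of "Suc i" "Suc j"] by simp
  qed
qed

lemma orthonormal_list_imp_ordered_basis:
  fixes vs :: "'a::euclidean_space list"
  assumes "orthonormal_list vs" "length vs = DIM('a)"
  shows "ordered_basis vs"
proof -
  let ?e = "\<lambda>i. vs ! (i - 1)"
  have e: "orthonormal_family ?e DIM('a)"
    using assms by (simp add: orthonormal_list_iff_family)
  have set: "?e ` {1..DIM('a)} = set vs"
  proof -
    have "?e ` {1..DIM('a)} = (!) vs ` {0..<DIM('a)}"
      by (force simp: image_iff intro: bexI[where x="Suc _"])
    then show ?thesis using assms(2) by (metis list.set_map map_nth set_upt)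
  qed
  have "card (set vs) = length vs"
    using card_image[OF orthonormal_family_inj_on[OF e]] set assms(2) by simp
  then have "distinct vs" by (rule card_distinct)
  moreover have "independent (set vs)"
    using orthonormal_family_independent[OF e] set by simp
  moreover have "span (set vs) = UNIV"
    using orthonormal_family_dim_span[OF e] set by (metis dim_eq_full span_span)
  ultimately show ?thesis by (simp add: ordered_basis_def)
qed

text \<open>A kernel vector of the matrix would be the coefficient vector of a combination of
  \<open>cs\<close> with vanishing coordinates in \<open>bs\<close>. This combination is 0, so the
  independence of \<open>cs\<close> forces the coefficients to vanish.\<close>

lemma det_transition_matrix_nonzero:
  fixes bs cs :: "'a::euclidean_space list"
  assumes bs: "ordered_basis bs" and cs: "ordered_basis cs"
  shows "Determinant.det (transition_matrix bs cs) \<noteq> 0"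
proof
  let ?n = "DIM('a)" and ?T = "transition_matrix bs cs"
  have T: "?T \<in> carrier_mat ?n ?n" by (simp add: transition_matrix_def)
  have len: "length vs = ?n" if "ordered_basis vs" for vs :: "'a list"
    using that unfolding ordered_basis_def
    by (metis dim_UNIV dim_eq_card_independent dim_span distinct_card)
  assume "Determinant.det ?T = 0"
  then obtain w where w: "w \<in> carrier_vec ?n" "w \<noteq> 0\<^sub>v ?n" "?T *\<^sub>v w = 0\<^sub>v ?n"
    using det_0_iff_vec_prod_zero_field[OF T] by blast
  define y where "y = (\<Sum>j<?n. vec_index w j *\<^sub>R cs ! j)"
  have rep_bs: "representation (set bs) y = (\<lambda>b. \<Sum>j<?n. vec_index w j * representation (set bs) (cs ! j) b)"
    unfolding y_def using bs
    by (simp add: ordered_basis_def representation_sum representation_scale)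
  have zero: "representation (set bs) y (bs ! i) = 0" if "i < ?n" for i
  proof -
    have "vec_index (?T *\<^sub>v w) i = (\<Sum>j<?n. representation (set bs) (cs ! j) (bs ! i) * vec_index w j)"
      using that w(1) by (simp add: transition_matrix_def scalar_prod_def atLeast0LessThan)
    then show ?thesis using w(3) that by (simp add: rep_bs mult.commute)
  qed
  have "y = (\<Sum>b\<in>set bs. representation (set bs) y b *\<^sub>R b)"
    by (rule sum_representation_eq[symmetric]) (use bs in \<open>auto simp: ordered_basis_def\<close>)
  also have "\<dots> = 0"
    by (rule sum.neutral) (use zero len[OF bs] in \<open>auto simp: in_set_conv_nth\<close>)
  finally have y0: "y = 0" .
  have "vec_index w i = 0" if i: "i < ?n" for i
  proof -
    have "representation (set cs) y (cs ! i) = (\<Sum>j<?n. vec_index w j * representation (set cs) (cs ! j) (cs ! i))"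
      unfolding y_def using cs
      by (simp add: ordered_basis_def representation_sum representation_scale)
    also have "\<dots> = (\<Sum>j<?n. if j = i then vec_index w j else 0)"
      using cs len[OF cs] i
      by (intro sum.cong) (auto simp: ordered_basis_def representation_basis nth_eq_iff_index_eq)
    also have "\<dots> = vec_index w i" using i by simp
    finally show ?thesis by (simp add: y0 representation_zero)
  qed
  then have "w = 0\<^sub>v ?n" using w(1) by (intro eq_vecI) auto
  then show False using w(2) by contradiction
qed

lemma det_transition_matrix_uminus_last:
  fixes bs xs :: "'a::euclidean_space list"
  assumes bs: "ordered_basis bs" and xs: "Suc (length xs) = DIM('a)"
  shows "Determinant.det (transition_matrix bs (xs @ [- v])) = - Determinant.det (transition_matrix bs (xs @ [v]))"
proof -
  let ?m = "length xs"
  have "transition_matrix bs (xs @ [- v]) = mat_multcol ?m (- 1) (transition_matrix bs (xs @ [v]))"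
    using xs bs
    by (intro eq_matI)
      (auto simp: transition_matrix_def nth_append ordered_basis_def representation_neg less_Suc_eq)
  also have "\<dots> = transition_matrix bs (xs @ [v]) * multrow_mat DIM('a) ?m (- 1)"
    by (rule multcol_mat[where nr="DIM('a)"]) (simp add: transition_matrix_def)
  finally have "Determinant.det (transition_matrix bs (xs @ [- v])) =
      Determinant.det (transition_matrix bs (xs @ [v])) * Determinant.det (multrow_mat DIM('a) ?m (- 1))"
    by (simp add: det_mult[where n="DIM('a)"] transition_matrix_def)
  moreover have "Determinant.det (multrow_mat DIM('a) ?m (- 1)) = (- 1 :: real)"
    by (rule det_multrow_mat) (use xs in simp)
  ultimately show ?thesis by simp
qed

lemma orthonormal_list_snoc_iff:
  fixes g :: "nat \<Rightarrow> 'a::euclidean_space"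
  assumes "0 < n"
  shows "orthonormal_list (map g [1..<n] @ [v]) \<longleftrightarrow> orthonormal_family (g(n := v)) n"
proof -
  have "(map g [1..<n] @ [v]) ! (i - 1) = (g(n := v)) i" if "i \<in> {1..n}" for i
    using that assms by (auto simp: nth_append)
  then show ?thesis
    using assms by (simp add: orthonormal_list_iff_family orthonormal_family_def)
qed

text \<open>This makes the \<open>THE\<close> in \<open>frenet_frame\<close> meaningful. The unit
  vectors orthogonal to a hyperplane are z and -z, and exchanging them flips the sign of the nonzero
  determinant, so exactly one is positive.\<close>

lemma positive_completion_ex1:
  fixes g :: "nat \<Rightarrow> 'a::euclidean_space"
  assumes \<Omega>: "is_orientation \<Omega>" and g: "orthonormal_family g (DIM('a) - 1)"
  shows "\<exists>!v. orthonormal_list (map g [1..<DIM('a)] @ [v]) \<and> map g [1..<DIM('a)] @ [v] \<in> \<Omega>"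
proof -
  let ?n = "DIM('a)" and ?xs = "map g [1..<DIM('a)]"
  obtain bs where bs: "ordered_basis bs"
    and \<Omega>_eq: "\<Omega> = {cs. ordered_basis cs \<and> Determinant.det (transition_matrix bs cs) > 0}"
    using \<Omega> by (auto simp: is_orientation_def)
  define d where "d v = Determinant.det (transition_matrix bs (?xs @ [v]))" for v
  have len: "Suc (length ?xs) = ?n" using DIM_positive[where 'a='a] by simp
  have d_uminus: "d (- v) = - d v" for v
    unfolding d_def by (rule det_transition_matrix_uminus_last[OF bs len])
  have on_iff: "orthonormal_list (?xs @ [v]) \<longleftrightarrow> orthonormal_family (g(?n := v)) ?n" for v
    by (rule orthonormal_list_snoc_iff) simp
  have mem_iff: "orthonormal_list (?xs @ [v]) \<and> ?xs @ [v] \<in> \<Omega> \<longleftrightarrow>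
      orthonormal_list (?xs @ [v]) \<and> d v > 0" for v
    using orthonormal_list_imp_ordered_basis[of "?xs @ [v]"] len by (auto simp: \<Omega>_eq d_def)
  have d_nonzero: "d v \<noteq> 0" if "orthonormal_list (?xs @ [v])" for v
    unfolding d_def using len that
    by (intro det_transition_matrix_nonzero[OF bs] orthonormal_list_imp_ordered_basis) auto
  have on_uminus: "orthonormal_list (?xs @ [- v])" if "orthonormal_list (?xs @ [v])" for v
    unfolding on_iff orthonormal_family_def
  proof (intro ballI)
    have von: "orthonormal_family (g(?n := v)) ?n" using that by (simp only: on_iff)
    fix i j assume ij: "i \<in> {1..?n}" "j \<in> {1..?n}"
    show "inner ((g(?n := - v)) i) ((g(?n := - v)) j) = (if i = j then 1 else 0)"
      using orthonormal_familyD[OF von ij] by (cases "i = ?n"; cases "j = ?n") auto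
  qed
  have "card (g ` {1..?n - 1}) \<le> ?n - 1"
    using card_image_le[of "{1..?n - 1}" g] by simp
  then have less: "card (g ` {1..?n - 1}) < dim (UNIV :: 'a set)"
    unfolding dim_UNIV using DIM_positive[where 'a='a] by linarith
  obtain z where z: "norm z = 1" "\<And>y. y \<in> g ` {1..?n - 1} \<Longrightarrow> inner z y = 0"
    by (rule subspace_meets_orthogonal_complement[OF subspace_UNIV _ less]) (simp, blast)
  have gz: "inner z (g j) = 0" "inner (g j) z = 0" if "j \<in> {1..?n - 1}" for j
    using z(2)[OF imageI[OF that]] by (simp_all add: inner_commute)
  have zon: "orthonormal_list (?xs @ [z])"
    unfolding on_iff orthonormal_family_def
  proof (intro ballI)
    fix i j assume "i \<in> {1..?n}" "j \<in> {1..?n}"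
    then consider "i \<in> {1..?n - 1}" "j \<in> {1..?n - 1}" | "i = ?n" "j \<in> {1..?n - 1}"
      | "i \<in> {1..?n - 1}" "j = ?n" | "i = ?n" "j = ?n" by force
    then show "inner ((g(?n := z)) i) ((g(?n := z)) j) = (if i = j then 1 else 0)"
      using orthonormal_familyD[OF g] gz z(1)
      by cases (auto simp: norm_eq_1)
  qed
  have "\<exists>v. orthonormal_list (?xs @ [v]) \<and> d v > 0"
  proof (cases "d z > 0")
    case True
    then show ?thesis using zon by blast
  next
    case False
    then have "d (- z) > 0" using d_nonzero[OF zon] by (simp add: d_uminus)
    then show ?thesis using on_uminus[OF zon] by blast
  qed
  moreover have "v = w" if v: "orthonormal_list (?xs @ [v])" "d v > 0"
    and w: "orthonormal_list (?xs @ [w])" "d w > 0" for v w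
  proof -
    have von: "orthonormal_family (g(?n := v)) ?n" and won: "orthonormal_family (g(?n := w)) ?n"
      using v(1) w(1) by (simp_all only: on_iff)
    have "span ((g(?n := v)) ` {1..?n}) = UNIV"
      using orthonormal_family_dim_span[OF von] by (metis dim_eq_full span_span)
    \<comment> \<open>\<open>w\<close> is orthogonal to all g_j with j < n, so only its component
      along \<open>v\<close> survives; both being unit vectors, the coefficient is 1 or -1.\<close>
    then have "w = (\<Sum>j\<in>{1..?n}. inner w ((g(?n := v)) j) *\<^sub>R (g(?n := v)) j)"
      by (intro orthonormal_family_expansion[OF von]) simp
    also have "\<dots> = (\<Sum>j\<in>{1..?n}. if j = ?n then inner w v *\<^sub>R v else 0)"
    proof (rule sum.cong)
      fix j assume "j \<in> {1..?n}"
      then show "inner w ((g(?n := v)) j) *\<^sub>R (g(?n := v)) j = (if j = ?n then inner w v *\<^sub>R v else 0)"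
        using orthonormal_familyD[OF won, of ?n j] by auto
    qed simp
    also have "\<dots> = inner w v *\<^sub>R v" using DIM_positive[where 'a='a] by (simp add: Suc_le_eq)
    finally have w_eq: "w = inner w v *\<^sub>R v" .
    have "inner v v = 1" "inner w w = 1"
      using orthonormal_familyD[OF von, of ?n ?n] orthonormal_familyD[OF won, of ?n ?n]
        DIM_positive[where 'a='a] by (simp_all add: Suc_le_eq)
    then have "norm v = 1" "norm w = 1" by (simp_all add: norm_eq_1)
    then have "\<bar>inner w v\<bar> = 1"
      using arg_cong[OF w_eq, of norm] by simp
    then have "inner w v = 1 \<or> inner w v = - 1" by linarith
    then show ?thesis
    proof
      assume "inner w v = - 1"
      then have "w = - v" using w_eq by simp
      then show ?thesis using v(2) w(2) by (simp add: d_uminus)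
    qed (use w_eq in simp)
  qed
  ultimately show ?thesis unfolding mem_iff by blast
qed

section \<open>Derivatives of the frame\<close>

text \<open>Only differentiating \<open>V i\<close> itself leads out of the span of V_1, ..., V_i;
  the derivatives of the projections and of the normalizing factor stay inside. The derivative is
  described modulo this span because the curvature tests it against the next frame vector, which is
  orthogonal to the span.\<close>

lemma gram_schmidt_has_vector_derivative:
  fixes V :: "nat \<Rightarrow> real \<Rightarrow> 'a::euclidean_space"
  assumes ind: "independent_family (\<lambda>k. V k t) m"
    and V: "\<And>k. k \<in> {1..m} \<Longrightarrow> (V k has_vector_derivative V (Suc k) t) (at t within S)"
    and i: "i \<in> {1..m}"
  shows "\<exists>D. ((\<lambda>s. gram_schmidt (\<lambda>k. V k s) i) has_vector_derivative D) (at t within S) \<and>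
    D - (1 / norm (gs_residual (\<lambda>k. V k t) i)) *\<^sub>R V (Suc i) t \<in> span ((\<lambda>k. V k t) ` {1..i})"
  using i
proof (induction i rule: less_induct)
  case (less i)
  let ?W = "\<lambda>i. span ((\<lambda>k. V k t) ` {1..i})"
  define E where "E j s = gram_schmidt (\<lambda>k. V k s) j" for j s
  define R where "R s = gs_residual (\<lambda>k. V k s) i" for s
  have W_mono: "?W j \<subseteq> ?W k" if "j \<le> k" for j k
    by (rule span_mono) (use that in auto)
  have V_mem: "V j t \<in> ?W k" if "j \<in> {1..k}" for j k
    by (rule span_base) (use that in simp)
  \<comment> \<open>The derivative of an earlier vector E_j involves at most V_{j+1}, and j + 1
    \<le> i.\<close>
  have IH: "\<exists>D. (E j has_vector_derivative D) (at t within S) \<and> D \<in> ?W i" if j: "j \<in> {1..<i}" for j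
  proof -
    obtain D where D: "(E j has_vector_derivative D) (at t within S)"
      "D - (1 / norm (gs_residual (\<lambda>k. V k t) j)) *\<^sub>R V (Suc j) t \<in> ?W j"
      using less.IH[of j] j less.prems unfolding E_def by auto
    have "D - (1 / norm (gs_residual (\<lambda>k. V k t) j)) *\<^sub>R V (Suc j) t \<in> ?W i"
      using D(2) W_mono[of j i] j by auto
    moreover have "(1 / norm (gs_residual (\<lambda>k. V k t) j)) *\<^sub>R V (Suc j) t \<in> ?W i"
      using j by (intro span_scale V_mem) simp
    ultimately have "D \<in> ?W i" using span_add by fastforce
    then show ?thesis using D(1) by blast
  qed
  then obtain D where D: "\<And>j. j \<in> {1..<i} \<Longrightarrow> (E j has_vector_derivative D j) (at t within S)"
    "\<And>j. j \<in> {1..<i} \<Longrightarrow> D j \<in> ?W i"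
    by metis
  \<comment> \<open>\<open>Q\<close> is the derivative of the projection that is subtracted in the
    residual, by the product rule.\<close>
  define Q where "Q = (\<Sum>j\<in>{1..<i}. inner (V i t) (E j t) *\<^sub>R D j
      + (inner (V i t) (D j) + inner (V (Suc i) t) (E j t)) *\<^sub>R E j t)"
  have R_eq: "R = (\<lambda>s. V i s - (\<Sum>j\<in>{1..<i}. inner (V i s) (E j s) *\<^sub>R E j s))"
    by (simp add: R_def gs_residual_def E_def fun_eq_iff)
  have R_deriv: "(R has_vector_derivative (V (Suc i) t - Q)) (at t within S)"
    unfolding R_eq Q_def
    by (intro has_vector_derivative_diff has_vector_derivative_sum
        bounded_bilinear.has_vector_derivative[OF bounded_bilinear_scaleR]
        bounded_bilinear.has_vector_derivative[OF bounded_bilinear_inner] V less.prems D(1))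
  have R0: "R t \<noteq> 0"
    using gram_schmidt_properties[OF ind] less.prems by (simp add: R_def)
  have E_mem: "E j t \<in> ?W i" if "j \<in> {1..i}" for j
  proof -
    have "E j t \<in> span (gram_schmidt (\<lambda>k. V k t) ` {1..i})"
      unfolding E_def by (rule span_base) (use that in simp)
    then show ?thesis using gram_schmidt_span[OF ind, of i] less.prems by simp
  qed
  have R_mem: "R t \<in> ?W i"
    unfolding R_eq using less.prems
    by (intro span_diff span_sum span_scale V_mem E_mem) auto
  have Q_mem: "Q \<in> ?W i"
    unfolding Q_def by (intro span_sum span_add span_scale D(2) E_mem) auto
  \<comment> \<open>The norm is differentiable away from 0. The derivative \<open>d\<close> is left
    unevaluated: it multiplies \<open>R t\<close>, which lies in the span.\<close>
  have "(\<lambda>s. inverse (norm (R s))) differentiable (at t within S)"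
    using R0 by (intro differentiable_inverse differentiable_compose[of norm R]
        differentiable_norm_at differentiableI_vector[OF R_deriv]) auto
  then obtain d where d: "((\<lambda>s. inverse (norm (R s))) has_vector_derivative d) (at t within S)"
    using vector_derivative_works by blast
  have "E i = (\<lambda>s. inverse (norm (R s)) *\<^sub>R R s)"
    by (simp add: E_def R_def gram_schmidt_eq sgn_div_norm fun_eq_iff)
  then have "(E i has_vector_derivative (inverse (norm (R t)) *\<^sub>R (V (Suc i) t - Q) + d *\<^sub>R R t)) (at t within S)"
    using bounded_bilinear.has_vector_derivative[OF bounded_bilinear_scaleR d R_deriv] by simp
  moreover have "inverse (norm (R t)) *\<^sub>R (V (Suc i) t - Q) + d *\<^sub>R R t - (1 / norm (R t)) *\<^sub>R V (Suc i) t
      = d *\<^sub>R R t - inverse (norm (R t)) *\<^sub>R Q"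
    by (simp add: scaleR_diff_right inverse_eq_divide)
  moreover have "d *\<^sub>R R t - inverse (norm (R t)) *\<^sub>R Q \<in> ?W i"
    by (intro span_diff span_scale R_mem Q_mem)
  ultimately show ?case unfolding E_def R_def by metis
qed

section \<open>Derivatives of a regular curve and of its affine image\<close>

lemma nth_vderiv_0: "nth_vderiv a b 0 c = c"
  by (simp add: nth_vderiv_def)

lemma nth_vderiv_Suc:
  "nth_vderiv a b (Suc k) c t = vector_derivative (nth_vderiv a b k c) (at t within {a..b})"
  by (simp add: nth_vderiv_def)

lemma regular_curve_has_vector_derivative:
  fixes c :: "real \<Rightarrow> 'a::euclidean_space"
  assumes "regular_curve a b c" "k < DIM('a)" "t \<in> {a..b}"
  shows "(nth_vderiv a b k c has_vector_derivative nth_vderiv a b (Suc k) c t) (at t within {a..b})"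
  using assms unfolding nth_vderiv_Suc vector_derivative_works[symmetric]
  by (auto simp: regular_curve_def differentiable_on_def)

lemma regular_curve_independent_family:
  fixes c :: "real \<Rightarrow> 'a::euclidean_space"
  assumes "regular_curve a b c" "t \<in> {a..b}"
  shows "independent_family (\<lambda>k. nth_vderiv a b k c t) (DIM('a) - 1)"
proof -
  have "{1..<DIM('a)} = {1..DIM('a) - 1}" using DIM_positive[where 'a='a] by auto
  then show ?thesis
    using assms by (intro independent_familyI) (auto simp: regular_curve_def)
qed

lemma nth_vderiv_affine_image:
  fixes c :: "real \<Rightarrow> 'a::euclidean_space"
  assumes c: "regular_curve a b c" and L: "linear L" and k: "k \<le> DIM('a)" and t: "t \<in> {a..b}"
  shows "nth_vderiv a b k (\<lambda>s. L (c s) + v) t = L (nth_vderiv a b k c t) + (if k = 0 then v else 0)"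
    and "k < DIM('a) \<Longrightarrow> (nth_vderiv a b k (\<lambda>s. L (c s) + v) has_vector_derivative
          L (nth_vderiv a b (Suc k) c t)) (at t within {a..b})"
proof -
  let ?c = "\<lambda>s. L (c s) + v"
  have ab: "a < b" using c by (simp add: regular_curve_def)
  \<comment> \<open>The equality is assumed on the whole interval, since a derivative at one point
    depends on nearby values; the induction for \<open>all\<close> supplies it. The translation by
    \<open>v\<close> is constant and survives only for k = 0.\<close>
  have step: "(nth_vderiv a b k ?c has_vector_derivative L (nth_vderiv a b (Suc k) c t)) (at t within {a..b})"
    if k: "k < DIM('a)" and t: "t \<in> {a..b}"
      and eq: "\<And>s. s \<in> {a..b} \<Longrightarrow> nth_vderiv a b k ?c s = L (nth_vderiv a b k c s) + (if k = 0 then v else 0)" for k t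
  proof (rule has_vector_derivative_transform[OF t eq])
    have "((\<lambda>s. L (nth_vderiv a b k c s)) has_vector_derivative L (nth_vderiv a b (Suc k) c t)) (at t within {a..b})"
      by (rule bounded_linear.has_vector_derivative[OF L[unfolded linear_conv_bounded_linear]
            regular_curve_has_vector_derivative[OF c k t]])
    then show "((\<lambda>s. L (nth_vderiv a b k c s) + (if k = 0 then v else 0)) has_vector_derivative
        L (nth_vderiv a b (Suc k) c t)) (at t within {a..b})"
      by (simp only: has_vector_derivative_add_const)
  qed
  have all: "nth_vderiv a b k ?c t = L (nth_vderiv a b k c t) + (if k = 0 then v else 0)"
    if "k \<le> DIM('a)" "t \<in> {a..b}" for k t
    using that
  proof (induction k arbitrary: t)
    case 0
    then show ?case by (simp add: nth_vderiv_0)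
  next
    case (Suc k)
    have "(nth_vderiv a b k ?c has_vector_derivative L (nth_vderiv a b (Suc k) c t)) (at t within {a..b})"
      using Suc by (intro step) auto
    then show ?case
      by (simp add: nth_vderiv_Suc[of a b k ?c] vector_derivative_within_closed_interval[OF ab Suc.prems(2)])
  qed
  show "nth_vderiv a b k ?c t = L (nth_vderiv a b k c t) + (if k = 0 then v else 0)"
    by (rule all[OF k t])
  show "(nth_vderiv a b k ?c has_vector_derivative L (nth_vderiv a b (Suc k) c t)) (at t within {a..b})"
    if "k < DIM('a)"
    using that t by (intro step all) auto
qed

lemma regular_curve_affine_image:
  fixes c :: "real \<Rightarrow> 'a::euclidean_space" and L :: "'a \<Rightarrow> 'a"
  assumes c: "regular_curve a b c" and L: "linear L" "inj L"
  shows "regular_curve a b (\<lambda>s. L (c s) + v)"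
  unfolding regular_curve_def
proof (intro conjI allI impI ballI)
  let ?c = "\<lambda>s. L (c s) + v"
  show "a < b" using c by (simp add: regular_curve_def)
  show "nth_vderiv a b k ?c differentiable_on {a..b}" if k: "k < DIM('a)" for k
    unfolding differentiable_on_def
  proof
    fix t assume "t \<in> {a..b}"
    from nth_vderiv_affine_image(2)[OF c L(1) less_imp_le[OF k] this k]
    show "nth_vderiv a b k ?c differentiable (at t within {a..b})"
      by (rule differentiableI_vector)
  qed
  fix t assume t: "t \<in> {a..b}"
  have eq: "nth_vderiv a b k ?c t = L (nth_vderiv a b k c t)" if "k \<in> {1..<DIM('a)}" for k
    using nth_vderiv_affine_image(1)[OF c L(1) _ t, of k v] that by auto
  have "inj_on (\<lambda>k. nth_vderiv a b k c t) {1..<DIM('a)}"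
    and ind: "independent ((\<lambda>k. nth_vderiv a b k c t) ` {1..<DIM('a)})"
    using c t by (auto simp: regular_curve_def)
  then have "inj_on (\<lambda>k. L (nth_vderiv a b k c t)) {1..<DIM('a)}"
    using L(2) by (auto simp: inj_on_def)
  then show "inj_on (\<lambda>k. nth_vderiv a b k ?c t) {1..<DIM('a)}"
    by (subst inj_on_cong[OF eq])
  have "independent (L ` (\<lambda>k. nth_vderiv a b k c t) ` {1..<DIM('a)})"
    using ind L by (intro linear_independent_injective_image) (auto intro: inj_on_subset)
  moreover have "(\<lambda>k. nth_vderiv a b k ?c t) ` {1..<DIM('a)} = L ` (\<lambda>k. nth_vderiv a b k c t) ` {1..<DIM('a)}"
    unfolding image_image by (rule image_cong) (use eq in auto)
  ultimately show "independent ((\<lambda>k. nth_vderiv a b k ?c t) ` {1..<DIM('a)})" by simp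
qed

section \<open>Curvatures as ratios of volumes\<close>

lemma frenet_frame_eq_gram_schmidt:
  fixes c :: "real \<Rightarrow> 'a::euclidean_space"
  assumes "i < DIM('a)"
  shows "frenet_frame \<Omega> a b c i t = gram_schmidt (\<lambda>k. nth_vderiv a b k c t) i"
  using assms by (simp add: frenet_frame_def)

lemma frenet_frame_orthonormal:
  fixes c :: "real \<Rightarrow> 'a::euclidean_space"
  assumes \<Omega>: "is_orientation \<Omega>" and c: "regular_curve a b c" and t: "t \<in> {a..b}"
  shows "orthonormal_family (\<lambda>i. frenet_frame \<Omega> a b c i t) DIM('a)"
proof -
  let ?e = "gram_schmidt (\<lambda>k. nth_vderiv a b k c t)" and ?n = "DIM('a)"
  have "orthonormal_family ?e (?n - 1)"
    using gram_schmidt_properties[OF regular_curve_independent_family[OF c t]] by blast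
  from theI'[OF positive_completion_ex1[OF \<Omega> this]]
  have "orthonormal_list (map ?e [1..<?n] @ [frenet_frame \<Omega> a b c ?n t])"
    by (simp add: frenet_frame_def Let_def)
  then have "orthonormal_family (?e(?n := frenet_frame \<Omega> a b c ?n t)) ?n"
    by (simp only: orthonormal_list_snoc_iff[OF DIM_positive])
  moreover have "(?e(?n := frenet_frame \<Omega> a b c ?n t)) i = frenet_frame \<Omega> a b c i t" if "i \<in> {1..?n}" for i
    using that by (auto simp: frenet_frame_eq_gram_schmidt)
  ultimately show ?thesis by (simp add: orthonormal_family_def)
qed

text \<open>For i < n this is the Gram-Schmidt flag. For i = n the frame spans the whole space,
  which settles the case even where c^(n) depends on the lower derivatives.\<close>

lemma frenet_frame_span:
  fixes c :: "real \<Rightarrow> 'a::euclidean_space"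
  assumes \<Omega>: "is_orientation \<Omega>" and c: "regular_curve a b c" and t: "t \<in> {a..b}" and i: "i \<in> {1..DIM('a)}"
  shows "nth_vderiv a b i c t \<in> span ((\<lambda>i. frenet_frame \<Omega> a b c i t) ` {1..i})"
proof (cases "i = DIM('a)")
  case True
  have "span ((\<lambda>i. frenet_frame \<Omega> a b c i t) ` {1..DIM('a)}) = UNIV"
    using orthonormal_family_dim_span[OF frenet_frame_orthonormal[OF \<Omega> c t]]
    by (metis dim_eq_full span_span)
  then show ?thesis using True by simp
next
  case False
  let ?v = "\<lambda>k. nth_vderiv a b k c t"
  have "(\<lambda>i. frenet_frame \<Omega> a b c i t) ` {1..i} = gram_schmidt ?v ` {1..i}"
    by (rule image_cong) (use False i in \<open>auto simp: frenet_frame_eq_gram_schmidt\<close>)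
  moreover have "span (gram_schmidt ?v ` {1..i}) = span (?v ` {1..i})"
    by (rule gram_schmidt_span[OF regular_curve_independent_family[OF c t]]) (use False i in auto)
  moreover have "?v i \<in> span (?v ` {1..i})"
    by (rule span_base) (use i in simp)
  ultimately show ?thesis by simp
qed

text \<open>The diagonal of the triangular matrix of the derivatives in the Frenet frame. For i < n
  it is the distance of c^(i) from the preceding span; for i = n it is signed by the
  orientation.\<close>

definition frenet_height ::
    "'a::euclidean_space list set \<Rightarrow> real \<Rightarrow> real \<Rightarrow> (real \<Rightarrow> 'a) \<Rightarrow> real \<Rightarrow> nat \<Rightarrow> real" where
  "frenet_height \<Omega> a b c t i = inner (nth_vderiv a b i c t) (frenet_frame \<Omega> a b c i t)"

lemma frenet_height_pos:
  fixes c :: "real \<Rightarrow> 'a::euclidean_space"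
  assumes "regular_curve a b c" "t \<in> {a..b}" "i \<in> {1..<DIM('a)}"
  shows "frenet_height \<Omega> a b c t i = norm (gs_residual (\<lambda>k. nth_vderiv a b k c t) i)"
    and "frenet_height \<Omega> a b c t i > 0"
  using gram_schmidt_properties[OF regular_curve_independent_family[OF assms(1,2)]] assms(3)
  by (auto simp: frenet_height_def frenet_frame_eq_gram_schmidt)

text \<open>Modulo the span of c', ..., c^(r), to which e_{r+1} is orthogonal, the derivative of e_r
  is c^(r+1) / w_r. The remaining divisor, the speed, is w_1.\<close>

lemma curvature_eq_height_ratio:
  fixes c :: "real \<Rightarrow> 'a::euclidean_space"
  assumes \<Omega>: "is_orientation \<Omega>" and c: "regular_curve a b c" and t: "t \<in> {a..b}"
    and r: "1 \<le> r" "r < DIM('a)"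
  defines "w \<equiv> frenet_height \<Omega> a b c t"
  shows "curvature \<Omega> a b c r t = w (Suc r) / (w r * w 1)"
proof -
  let ?V = "\<lambda>k. nth_vderiv a b k c" and ?e = "\<lambda>i. frenet_frame \<Omega> a b c i t"
  have ab: "a < b" using c by (simp add: regular_curve_def)
  note on = frenet_frame_orthonormal[OF \<Omega> c t]
  have w_res: "w r = norm (gs_residual (\<lambda>k. ?V k t) r)"
    unfolding w_def by (rule frenet_height_pos(1)[OF c t]) (use r in simp)
  obtain D where D: "((\<lambda>s. gram_schmidt (\<lambda>k. ?V k s) r) has_vector_derivative D) (at t within {a..b})"
    "D - (1 / w r) *\<^sub>R ?V (Suc r) t \<in> span ((\<lambda>k. ?V k t) ` {1..r})"
    using gram_schmidt_has_vector_derivative[where V="?V" and t=t and S="{a..b}" and i=r,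
        OF regular_curve_independent_family[OF c t]]
      regular_curve_has_vector_derivative[OF c _ t] r unfolding w_res by fastforce
  have frame: "frenet_frame \<Omega> a b c r = (\<lambda>s. gram_schmidt (\<lambda>k. ?V k s) r)"
    using r by (simp add: frenet_frame_eq_gram_schmidt fun_eq_iff)
  have D_eq: "vector_derivative (frenet_frame \<Omega> a b c r) (at t within {a..b}) = D"
    unfolding frame by (rule vector_derivative_within_closed_interval[OF ab t D(1)])
  have "Linear_Algebra.orthogonal (?e (Suc r)) (?V j t)" if j: "j \<in> {1..r}" for j
  proof (rule orthogonal_to_span[OF frenet_frame_span[OF \<Omega> c t]])
    show "j \<in> {1..DIM('a)}" using j r by simp
    fix y assume "y \<in> ?e ` {1..j}"
    then obtain k where "k \<in> {1..j}" "y = ?e k" by blast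
    then show "Linear_Algebra.orthogonal (?e (Suc r)) y"
      using orthonormal_familyD[OF on, of "Suc r" k] j r by (simp add: Linear_Algebra.orthogonal_def)
  qed
  then have "Linear_Algebra.orthogonal (?e (Suc r)) (D - (1 / w r) *\<^sub>R ?V (Suc r) t)"
    by (intro orthogonal_to_span[OF D(2)]) blast
  then have "inner D (?e (Suc r)) = w (Suc r) / w r"
    by (simp add: Linear_Algebra.orthogonal_def inner_diff_right inner_commute w_def frenet_height_def)
  moreover have "norm (vector_derivative c (at t within {a..b})) = w 1"
  proof -
    have "w 1 = norm (gs_residual (\<lambda>k. ?V k t) 1)"
      unfolding w_def by (rule frenet_height_pos(1)[OF c t]) (use r in simp)
    then show ?thesis by (simp add: gs_residual_def nth_vderiv_Suc nth_vderiv_0)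
  qed
  ultimately show ?thesis by (simp add: curvature_def D_eq)
qed

text \<open>\<open>P\<close> and \<open>Q\<close> are only nonnegative because \<open>P\<close>
  becomes V_{r+1}, which for r = n - 1 vanishes where the torsion does. The denominators involve V_r
  and V_1, which are positive.\<close>

lemma quotient_bounds:
  fixes P Q R S P' Q' R' S' :: real
  assumes P: "0 \<le> P" "d1 * P \<le> P'" "P' \<le> u1 * P" and Q: "0 \<le> Q" "d2 * Q \<le> Q'" "Q' \<le> u2 * Q"
    and R: "0 < R" "d3 * R \<le> R'" "R' \<le> u3 * R" and S: "0 < S" "d4 * S \<le> S'" "S' \<le> u4 * S"
    and pos: "0 < d1" "0 < d2" "0 < d3" "0 < d4"
  shows "d1 * d2 / (u3\<^sup>2 * u4) * (P * Q / (R\<^sup>2 * S)) \<le> P' * Q' / (R'\<^sup>2 * S')"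
    and "P' * Q' / (R'\<^sup>2 * S') \<le> u1 * u2 / (d3\<^sup>2 * d4) * (P * Q / (R\<^sup>2 * S))"
proof -
  have "0 \<le> d1 * P" "0 \<le> d2 * Q" "0 < d3 * R" "0 < d4 * S" using assms by simp_all
  then have nonneg: "0 \<le> P'" "0 \<le> Q'" "0 < R'" "0 < S'" "0 \<le> u1 * P" "0 \<le> u2 * Q"
    using assms by linarith+
  have num: "(d1 * P) * (d2 * Q) \<le> P' * Q'" "P' * Q' \<le> (u1 * P) * (u2 * Q)"
    by (intro mult_mono; use assms nonneg in simp)+
  have den: "(d3 * R)\<^sup>2 * (d4 * S) \<le> R'\<^sup>2 * S'" "R'\<^sup>2 * S' \<le> (u3 * R)\<^sup>2 * (u4 * S)"
    by (intro mult_mono power_mono; use assms nonneg in simp)+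
  have "(d1 * P) * (d2 * Q) / ((u3 * R)\<^sup>2 * (u4 * S)) \<le> P' * Q' / (R'\<^sup>2 * S')"
    by (rule frac_le) (use num den nonneg in auto)
  then show "d1 * d2 / (u3\<^sup>2 * u4) * (P * Q / (R\<^sup>2 * S)) \<le> P' * Q' / (R'\<^sup>2 * S')"
    by (simp add: power_mult_distrib mult_ac)
  have "P' * Q' / (R'\<^sup>2 * S') \<le> (u1 * P) * (u2 * Q) / ((d3 * R)\<^sup>2 * (d4 * S))"
    by (rule frac_le) (use num den assms nonneg in auto)
  then show "P' * Q' / (R'\<^sup>2 * S') \<le> u1 * u2 / (d3\<^sup>2 * d4) * (P * Q / (R\<^sup>2 * S))"
    by (simp add: power_mult_distrib mult_ac)
qed

text \<open>All heights involved have index below n, so they are norms of nonzero residuals.\<close>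

lemma curvature_pos:
  fixes c :: "real \<Rightarrow> 'a::euclidean_space"
  assumes "is_orientation \<Omega>" "regular_curve a b c" "t \<in> {a..b}" "1 \<le> r" "Suc r < DIM('a)"
  shows "curvature \<Omega> a b c r t > 0"
proof -
  have "frenet_height \<Omega> a b c t i > 0" if "i \<in> {1, r, Suc r}" for i
    using that assms by (intro frenet_height_pos(2)) auto
  then show ?thesis
    using assms by (subst curvature_eq_height_ratio) auto
qed

text \<open>Heights are quotients of successive volumes: |w_{r+1}| = V_{r+1} / V_r and w_r = V_r /
  V_{r-1}. For r = 1 the empty product gives V_0 = 1.\<close>

lemma abs_curvature_eq_volume_ratio:
  fixes c :: "real \<Rightarrow> 'a::euclidean_space"
  assumes \<Omega>: "is_orientation \<Omega>" and c: "regular_curve a b c" and t: "t \<in> {a..b}"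
    and r: "1 \<le> r" "r < DIM('a)"
  defines "V \<equiv> \<lambda>k. \<bar>\<Prod>i\<in>{1..k}. frenet_height \<Omega> a b c t i\<bar>"
  shows "\<bar>curvature \<Omega> a b c r t\<bar> = V (Suc r) * V (r - 1) / ((V r)\<^sup>2 * V 1)"
    and "\<And>k. k < DIM('a) \<Longrightarrow> 0 < V k"
proof -
  let ?w = "frenet_height \<Omega> a b c t"
  have pos: "0 < ?w i" if "i \<in> {1..<DIM('a)}" for i
    using frenet_height_pos(2)[OF c t that] .
  show V_pos: "0 < V k" if "k < DIM('a)" for k
  proof -
    have "0 < (\<Prod>i\<in>{1..k}. ?w i)" using that by (intro prod_pos) (auto intro!: pos)
    then show ?thesis by (simp add: V_def)
  qed
  obtain s where s: "r = Suc s" using r(1) by (cases r) auto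
  have w: "0 < ?w r" "0 < ?w 1" using r by (auto intro!: pos)
  have "V (Suc r) = V s * ?w r * \<bar>?w (Suc r)\<bar>" "V r = V s * ?w r" "V 1 = ?w 1"
    using w by (simp_all add: V_def s abs_mult)
  then have "V (Suc r) * V (r - 1) / ((V r)\<^sup>2 * V 1) = \<bar>?w (Suc r)\<bar> / (?w r * ?w 1)"
    using V_pos[of s] w r(2) s by (simp add: power2_eq_square divide_simps)
  also have "\<dots> = \<bar>curvature \<Omega> a b c r t\<bar>"
    unfolding curvature_eq_height_ratio[OF \<Omega> c t r] using w by (simp add: abs_mult)
  finally show "\<bar>curvature \<Omega> a b c r t\<bar> = V (Suc r) * V (r - 1) / ((V r)\<^sup>2 * V 1)" ..
qed

text \<open>Each frame is adapted to the flag of derivatives of its own curve, and \<open>L\<close>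
  maps one flag of derivatives to the other. So the volume bounds apply with these two frames for
  every k up to n, and the volume formula for the curvature combines them.\<close>

lemma abs_curvature_affine_image_bounds:
  fixes c :: "real \<Rightarrow> 'a::euclidean_space" and L :: "'a \<Rightarrow> 'a" and v :: 'a
  assumes \<Omega>: "is_orientation \<Omega>" and c: "regular_curve a b c" and t: "t \<in> {a..b}"
    and L: "linear L" "bij L" and \<sigma>: "singular_values L \<sigma>" and r: "1 \<le> r" "r < DIM('a)"
  defines "\<kappa> \<equiv> curvature \<Omega> a b c r t"
    and "\<kappa>' \<equiv> curvature \<Omega> a b (\<lambda>s. L (c s) + v) r t"
    and "U \<equiv> \<lambda>k. \<Prod>i\<in>{1..k}. \<sigma> i"
    and "D \<equiv> \<lambda>k. \<Prod>i\<in>{DIM('a) - k + 1..DIM('a)}. \<sigma> i"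
  shows "D (Suc r) * D (r - 1) / ((U r)\<^sup>2 * U 1) * \<bar>\<kappa>\<bar> \<le> \<bar>\<kappa>'\<bar>"
    and "\<bar>\<kappa>'\<bar> \<le> U (Suc r) * U (r - 1) / ((D r)\<^sup>2 * D 1) * \<bar>\<kappa>\<bar>"
proof -
  let ?c = "\<lambda>s. L (c s) + v"
  have inj: "inj L" using L(2) by (simp add: bij_def)
  have c': "regular_curve a b ?c" by (rule regular_curve_affine_image[OF c L(1) inj])
  define V where "V k = \<bar>\<Prod>i\<in>{1..k}. frenet_height \<Omega> a b c t i\<bar>" for k
  define V' where "V' k = \<bar>\<Prod>i\<in>{1..k}. frenet_height \<Omega> a b ?c t i\<bar>" for k
  have V: "\<bar>\<kappa>\<bar> = V (Suc r) * V (r - 1) / ((V r)\<^sup>2 * V 1)" "\<And>k. k < DIM('a) \<Longrightarrow> 0 < V k"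
    unfolding \<kappa>_def V_def by (fact abs_curvature_eq_volume_ratio[OF \<Omega> c t r])+
  have V': "\<bar>\<kappa>'\<bar> = V' (Suc r) * V' (r - 1) / ((V' r)\<^sup>2 * V' 1)"
    unfolding \<kappa>'_def V'_def by (rule abs_curvature_eq_volume_ratio(1)[OF \<Omega> c' t r])
  have pos: "\<sigma> i > 0" if "i \<in> {1..DIM('a)}" for i
    using singular_values_pos[OF L(1) inj \<sigma> that] .
  have D_pos: "0 < D k" if "k \<le> DIM('a)" for k
    unfolding D_def by (rule prod_pos) (use pos that in auto)
  have bounds: "D k * V k \<le> V' k" "V' k \<le> U k * V k" if k: "k \<le> DIM('a)" for k
  proof -
    have image: "nth_vderiv a b i ?c t = L (nth_vderiv a b i c t)" if "i \<in> {1..k}" for i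
      using nth_vderiv_affine_image(1)[OF c L(1) _ t, of i v] that k by auto
    have V'_eq: "V' k = \<bar>\<Prod>i\<in>{1..k}. inner (L (nth_vderiv a b i c t)) (frenet_frame \<Omega> a b ?c i t)\<bar>"
      unfolding V'_def frenet_height_def by (intro arg_cong[where f=abs] prod.cong refl) (simp only: image)
    have V_eq: "V k = \<bar>\<Prod>i\<in>{1..k}. inner (nth_vderiv a b i c t) (frenet_frame \<Omega> a b c i t)\<bar>"
      by (simp add: V_def frenet_height_def)
    have mem: "nth_vderiv a b i c t \<in> span ((\<lambda>i. frenet_frame \<Omega> a b c i t) ` {1..i})" if "i \<in> {1..k}" for i
      by (rule frenet_frame_span[OF \<Omega> c t]) (use that k in auto)
    have mem': "L (nth_vderiv a b i c t) \<in> span ((\<lambda>i. frenet_frame \<Omega> a b ?c i t) ` {1..i})" if "i \<in> {1..k}" for i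
      unfolding image[OF that, symmetric] by (rule frenet_frame_span[OF \<Omega> c' t]) (use that k in auto)
    note on = orthonormal_family_mono[OF frenet_frame_orthonormal[OF \<Omega> c t] k]
      and on' = orthonormal_family_mono[OF frenet_frame_orthonormal[OF \<Omega> c' t] k]
    show "D k * V k \<le> V' k"
      unfolding V_eq V'_eq D_def
      by (rule triangular_prod_singular_bounds(2)[OF L \<sigma> k on mem on' mem'])
    show "V' k \<le> U k * V k"
      unfolding V_eq V'_eq U_def
      by (rule triangular_prod_singular_bounds(1)[OF L \<sigma> k on mem on' mem'])
  qed
  have V_nonneg: "0 \<le> V k" for k by (simp add: V_def)
  have le: "Suc r \<le> DIM('a)" "r - 1 \<le> DIM('a)" "r \<le> DIM('a)" "1 \<le> DIM('a)" using r by auto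
  \<comment> \<open>The volume bounds are used for k = r + 1, r - 1, r and 1.\<close>
  note qb = quotient_bounds[OF V_nonneg bounds[OF le(1)] V_nonneg bounds[OF le(2)]
      V(2)[OF r(2)] bounds[OF le(3)] V(2)[OF order.strict_trans1[OF r]] bounds[OF le(4)]
      D_pos[OF le(1)] D_pos[OF le(2)] D_pos[OF le(3)] D_pos[OF le(4)]]
  show "D (Suc r) * D (r - 1) / ((U r)\<^sup>2 * U 1) * \<bar>\<kappa>\<bar> \<le> \<bar>\<kappa>'\<bar>"
    unfolding V(1) V' by (rule qb(1))
  show "\<bar>\<kappa>'\<bar> \<le> U (Suc r) * U (r - 1) / ((D r)\<^sup>2 * D 1) * \<bar>\<kappa>\<bar>"
    unfolding V(1) V' by (rule qb(2))
qed

theorem theorem2: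
  fixes c :: "real \<Rightarrow> 'a::euclidean_space" and \<Omega> :: "'a list set"
    and L :: "'a \<Rightarrow> 'a" and v :: 'a and a b :: real and n :: nat
    and c_tilde :: "real \<Rightarrow> 'a" and \<sigma> :: "nat \<Rightarrow> real" and \<kappa> \<kappa>_tilde :: "nat \<Rightarrow> real \<Rightarrow> real"
  assumes n: "n = DIM('a)" "n \<ge> 2"
    and orientation: "is_orientation \<Omega>"
    and regular: "regular_curve a b c"
    and L: "linear L" "bij L"
    and c_tilde: "c_tilde = (\<lambda>t. L (c t) + v)"
    and \<sigma>: "singular_values L \<sigma>"
    and \<kappa>: "\<kappa> = curvature \<Omega> a b c"
    and \<kappa>_tilde: "\<kappa>_tilde = curvature \<Omega> a b c_tilde"
  shows "\<forall>t\<in>{a..b}.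
     (\<forall>r. 1 \<le> r \<and> r \<le> n - 2 \<longrightarrow>
        (\<sigma> (n - r) * \<sigma> (n - r + 1) * (\<Prod>i=n-r+2..n. (\<sigma> i)\<^sup>2))
          / ((\<sigma> 1) ^ 3 * (\<Prod>i=2..r. (\<sigma> i)\<^sup>2)) * \<kappa> r t \<le> \<kappa>_tilde r t \<and>
        \<kappa>_tilde r t \<le> ((\<Prod>i=1..r-1. (\<sigma> i)\<^sup>2) * \<sigma> r * \<sigma> (r + 1))
          / ((\<Prod>i=n-r+1..n-1. (\<sigma> i)\<^sup>2) * (\<sigma> n) ^ 3) * \<kappa> r t) \<and>
     (\<sigma> n)\<^sup>2 / ((\<sigma> 1)\<^sup>2 * \<sigma> 2) * \<bar>\<kappa> (n - 1) t\<bar> \<le> \<bar>\<kappa>_tilde (n - 1) t\<bar> \<and>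
     \<bar>\<kappa>_tilde (n - 1) t\<bar> \<le> (\<sigma> 1)\<^sup>2 / (\<sigma> (n - 1) * (\<sigma> n)\<^sup>2) * \<bar>\<kappa> (n - 1) t\<bar>"
proof (intro ballI)
  fix t assume t: "t \<in> {a..b}"
  have inj: "inj L" using L(2) by (simp add: bij_def)
  have regular': "regular_curve a b c_tilde"
    unfolding c_tilde by (rule regular_curve_affine_image[OF regular L(1) inj])
  have pos: "\<sigma> i > 0" if "i \<in> {1..n}" for i
    using singular_values_pos[OF L(1) inj \<sigma>] that n(1) by simp
  define U where "U k = (\<Prod>i\<in>{1..k}. \<sigma> i)" for k
  define D where "D k = (\<Prod>i\<in>{n - k + 1..n}. \<sigma> i)" for k
  have bounds: "D (Suc r) * D (r - 1) / ((U r)\<^sup>2 * U 1) * \<bar>\<kappa> r t\<bar> \<le> \<bar>\<kappa>_tilde r t\<bar>"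
    "\<bar>\<kappa>_tilde r t\<bar> \<le> U (Suc r) * U (r - 1) / ((D r)\<^sup>2 * D 1) * \<bar>\<kappa> r t\<bar>" if "1 \<le> r" "r < n" for r
    using abs_curvature_affine_image_bounds[OF orientation regular t L \<sigma>, of r v] that
    by (simp_all add: U_def D_def \<kappa> \<kappa>_tilde c_tilde n(1))
  have U_1: "U 1 = \<sigma> 1" and D_1: "D 1 = \<sigma> n" using n(2) by (simp_all add: U_def D_def)
  have U_Suc: "U (Suc k) = U k * \<sigma> (Suc k)" for k by (simp add: U_def)
  have D_Suc: "D (Suc k) = \<sigma> (n - k) * D k" if "k < n" for k
  proof -
    have "{n - Suc k + 1..n} = insert (n - k) {n - k + 1..n}" using that by auto
    then show ?thesis by (simp add: D_def)
  qed
  \<comment> \<open>Both are the product of all singular values: \<open>L\<close> scales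
    n-dimensional volume by one exact factor. The torsion bounds simplify because of this.\<close>
  have D_n: "D n = U n" by (simp add: D_def U_def)
  have U_pos: "U k > 0" if "k \<le> n" for k
    unfolding U_def by (rule prod_pos) (use pos that in auto)
  have D_pos: "D k > 0" if "k \<le> n" for k
    unfolding D_def by (rule prod_pos) (use pos that in auto)
  have curv: "\<sigma> (n - r) * \<sigma> (n - r + 1) * (\<Prod>i=n-r+2..n. (\<sigma> i)\<^sup>2)
          / ((\<sigma> 1) ^ 3 * (\<Prod>i=2..r. (\<sigma> i)\<^sup>2)) * \<kappa> r t \<le> \<kappa>_tilde r t \<and>
        \<kappa>_tilde r t \<le> (\<Prod>i=1..r-1. (\<sigma> i)\<^sup>2) * \<sigma> r * \<sigma> (r + 1)
          / ((\<Prod>i=n-r+1..n-1. (\<sigma> i)\<^sup>2) * (\<sigma> n) ^ 3) * \<kappa> r t" if r: "1 \<le> r" "r \<le> n - 2" for r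
  proof -
    \<comment> \<open>Below the torsion, e_{r+1} is still a Gram-Schmidt vector, which makes both
      curvatures positive.\<close>
    have "Suc r < n" using r n(2) by linarith
    then have \<kappa>_pos: "0 < \<kappa> r t" "0 < \<kappa>_tilde r t"
      using curvature_pos[OF orientation _ t r(1)] regular regular' n(1) by (simp_all add: \<kappa> \<kappa>_tilde)
    obtain s where s: "r = Suc s" using r(1) by (cases r) auto
    have nr: "n - s = n - r + 1" "n - s + 1 = n - r + 2" using s \<open>Suc r < n\<close> by linarith+
    have "D (Suc r) = \<sigma> (n - r) * (\<sigma> (n - r + 1) * D s)"
      using D_Suc[of r] D_Suc[of s] s nr \<open>Suc r < n\<close> by simp
    moreover have "(D s)\<^sup>2 = (\<Prod>i=n-r+2..n. (\<sigma> i)\<^sup>2)"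
      unfolding D_def nr(2) by (rule prod_power_distrib)
    ultimately have lower_num: "D (Suc r) * D (r - 1) = \<sigma> (n - r) * \<sigma> (n - r + 1) * (\<Prod>i=n-r+2..n. (\<sigma> i)\<^sup>2)"
      by (simp add: s power2_eq_square)
    have "U r = \<sigma> 1 * (\<Prod>i\<in>{2..r}. \<sigma> i)"
      unfolding U_def using r(1) prod.atLeast_Suc_atMost[of 1 r \<sigma>] by (simp add: numeral_2_eq_2)
    \<comment> \<open>U_r contributes the square of \<sigma>_1 and U_1 one more factor, hence the
      cube; likewise for \<sigma>_n in \<open>upper_den\<close>.\<close>
    then have lower_den: "(U r)\<^sup>2 * U 1 = (\<sigma> 1) ^ 3 * (\<Prod>i=2..r. (\<sigma> i)\<^sup>2)"
      unfolding U_1 prod_power_distrib[symmetric] by (simp add: power3_eq_cube power2_eq_square)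
    have upper_num: "U (Suc r) * U (r - 1) = (\<Prod>i=1..r-1. (\<sigma> i)\<^sup>2) * \<sigma> r * \<sigma> (r + 1)"
      unfolding s prod_power_distrib[symmetric] by (simp add: U_def power2_eq_square)
    have "{n - r + 1..n} = insert n {n - r + 1..n - 1}" using r n(2) by auto
    moreover have "n \<notin> {n - r + 1..n - 1}" using n(2) by auto
    ultimately have "D r = \<sigma> n * (\<Prod>i\<in>{n - r + 1..n - 1}. \<sigma> i)"
      by (simp add: D_def)
    then have upper_den: "(D r)\<^sup>2 * D 1 = (\<Prod>i=n-r+1..n-1. (\<sigma> i)\<^sup>2) * (\<sigma> n) ^ 3"
      unfolding D_1 prod_power_distrib[symmetric] by (simp add: power3_eq_cube power2_eq_square)
    show ?thesis
      using bounds[of r] r \<kappa>_pos \<open>Suc r < n\<close>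
      unfolding lower_num lower_den upper_num upper_den by simp
  qed
  obtain m where m: "n = Suc (Suc m)" using n(2) by (metis add_2_eq_Suc le_Suc_ex)
  have \<sigma>_pos: "0 < \<sigma> 1" "0 < \<sigma> 2" "0 < \<sigma> (n - 1)" "0 < \<sigma> n"
    using n(2) by (auto intro!: pos)
  have D_eqs: "D n = \<sigma> 1 * D (n - 1)" "D (n - 1) = \<sigma> 2 * D (n - 2)"
    using D_Suc[of "n - 1"] D_Suc[of "n - 2"] by (simp_all add: m numeral_2_eq_2)
  have U_eqs: "U n = U (n - 1) * \<sigma> n" "U (n - 1) = U (n - 2) * \<sigma> (n - 1)"
    by (simp_all add: m U_Suc)
  have nz: "U (n - 1) \<noteq> 0" "D (n - 1) \<noteq> 0"
    using U_pos[of "n - 1"] D_pos[of "n - 1"] by auto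
  have lower: "D n * D (n - 2) / ((U (n - 1))\<^sup>2 * U 1) = (\<sigma> n)\<^sup>2 / ((\<sigma> 1)\<^sup>2 * \<sigma> 2)"
  proof -
    \<comment> \<open>With D_n = U_n the numerator becomes U_n^2 / (\<sigma>_1 \<sigma>_2), and the
      square of U_{n-1} cancels.\<close>
    have "D (n - 2) = U (n - 1) * \<sigma> n / (\<sigma> 1 * \<sigma> 2)"
      using D_eqs U_eqs(1) D_n \<sigma>_pos by (simp add: field_simps)
    then show ?thesis
      unfolding D_n U_eqs(1) U_1 using nz \<sigma>_pos by (simp add: field_simps power2_eq_square)
  qed
  have upper: "U n * U (n - 2) / ((D (n - 1))\<^sup>2 * D 1) = (\<sigma> 1)\<^sup>2 / (\<sigma> (n - 1) * (\<sigma> n)\<^sup>2)"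
  proof -
    \<comment> \<open>Dually, the numerator becomes D_n^2 / (\<sigma>_{n-1} \<sigma>_n), and the
      square of D_{n-1} cancels.\<close>
    have "U (n - 2) = \<sigma> 1 * D (n - 1) / (\<sigma> (n - 1) * \<sigma> n)"
      using D_eqs(1) U_eqs D_n \<sigma>_pos by (simp add: field_simps)
    then show ?thesis
      unfolding D_n[symmetric] D_eqs(1) D_1 using nz \<sigma>_pos by (simp add: field_simps power2_eq_square)
  qed
  have index: "Suc (n - 1) = n" "n - 1 - 1 = n - 2" and "1 \<le> n - 1" "n - 1 < n" using n(2) by simp_all
  note torsion = bounds[OF this(3,4), unfolded index lower upper]
  show "(\<forall>r. 1 \<le> r \<and> r \<le> n - 2 \<longrightarrow>
        (\<sigma> (n - r) * \<sigma> (n - r + 1) * (\<Prod>i=n-r+2..n. (\<sigma> i)\<^sup>2))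
          / ((\<sigma> 1) ^ 3 * (\<Prod>i=2..r. (\<sigma> i)\<^sup>2)) * \<kappa> r t \<le> \<kappa>_tilde r t \<and>
        \<kappa>_tilde r t \<le> ((\<Prod>i=1..r-1. (\<sigma> i)\<^sup>2) * \<sigma> r * \<sigma> (r + 1))
          / ((\<Prod>i=n-r+1..n-1. (\<sigma> i)\<^sup>2) * (\<sigma> n) ^ 3) * \<kappa> r t) \<and>
     (\<sigma> n)\<^sup>2 / ((\<sigma> 1)\<^sup>2 * \<sigma> 2) * \<bar>\<kappa> (n - 1) t\<bar> \<le> \<bar>\<kappa>_tilde (n - 1) t\<bar> \<and>
     \<bar>\<kappa>_tilde (n - 1) t\<bar> \<le> (\<sigma> 1)\<^sup>2 / (\<sigma> (n - 1) * (\<sigma> n)\<^sup>2) * \<bar>\<kappa> (n - 1) t\<bar>"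
    using curv torsion by blast
qed

end
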